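(* Let $\lambda>0$, $T>0$, $\Delta t=T/N$, $t_n=n\Delta t$, $a\in\mathbb{R}$, $s=a\Delta t^2$, with $\sqrt\lambda\,\Delta t$ small enough. Let $u$ solve $\ddot u+\lambda u=0$, $u(0)=\widehat u_0$, $\dot u(0)=\widehat u_1$. Consider the $\mathbb{P}^2$-DG scheme $\bm u_{n+1}=G\bm u_n$, $n=0,\dots,N-1$, with $G\in\mathbb{R}^{3\times3}$ and its eigen-decomposition $G=WDW^{-1}$ as defined in the context. Let $\bm u_n^{ex}=(u(t_{n-1}),u(t_{n-1/2}),u(t_n))^\top$ with $t_{n-1/2}=\frac12(t_{n-1}+t_n)$, $\bm e_n=\bm u_n^{ex}-\bm u_n$ with $\bm e_0=\bm0$, and $\bm\theta_n=\bm u_{n+1}^{ex}-G\bm u_n^{ex}$. Then $\bm\theta_n=O(\Delta t^3)$ for any $a\in\mathbb{R}$, $W^{-1}\bm\theta_n=O(\Delta t^2)$ for any $a\in\mathbb{R}$, and $W^{-1}\bm\theta_n=O(\Delta t^3)$ for $a=0$. Correspondingly, $\bm e_n=O(\Delta t^p)$ with $p=1$ for $a=-1/12$ and $a=-1/8$, and $p=2$ for $a=0$.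
   Context: $O(\cdot)$ is for $\Delta t\to0$ with $a,\lambda,T,\widehat u_0,\widehat u_1$ fixed, uniformly in $n$. For $n=0$, values of $u$ at negative times refer to the ODE solution extended to $\mathbb{R}$. Scheme: with $I_n=(t_{n-1},t_n]$, let $\psi_{n,1},\psi_{n,2},\psi_{n,3}$ be the Lagrange basis of $\mathbb{P}^2(I_n)$ for the nodes $t_{n-1},t_{n-1/2},t_n$. Put $G=-A_+^{-1}A_-$, where for $i,j=1,2,3$ $$A_{-,ij}=-\bigl(1+\tfrac s2\lambda\bigr)\dot\psi_{n,j}(t_n)\dot\psi_{n+1,i}(t_n)-\lambda\psi_{n,j}(t_n)\psi_{n+1,i}(t_n),$$ $$A_{+,ij}=\int_{I_{n+1}}\!\ddot\psi_{n+1,j}\dot\psi_{n+1,i}\,dt+\lambda\int_{I_{n+1}}\!\psi_{n+1,j}\dot\psi_{n+1,i}\,dt+\bigl(1-\tfrac s2\lambda\bigr)\dot\psi_{n+1,j}(t_n)\dot\psi_{n+1,i}(t_n)+\lambda\psi_{n+1,j}(t_n)\psi_{n+1,i}(t_n)$$ (these matrices do not depend on $n$; point values at $t_n$ are one-sided limits from the corresponding slab). Eigen-decomposition: $$D=\mathrm{diag}(0,\lambda_1,\lambda_2),\qquad W=\begin{bmatrix}1&1&1\\ \frac14&\widehat\lambda_1&\widehat\lambda_2\\ 0&\lambda_1&\lambda_2\end{bmatrix},$$ $$\lambda_{1,2}=\frac{(6a-1)\Delta t^4\lambda^2+60\Delta t^2\lambda-144\pm\Delta t\,R}{(18a-2)\Delta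 t^4\lambda^2+(72a-12)\Delta t^2\lambda-144},$$ $$\widehat\lambda_{1,2}=\frac{(1-6a)\Delta t^6\lambda^3-(288a+24)\Delta t^4\lambda^2-(864a+432)\Delta t^2\lambda+3456\mp(\Delta t^3\lambda+12\Delta t)R}{(36a-4)\Delta t^6\lambda^3+(24-288a)\Delta t^4\lambda^2-1728a\Delta t^2\lambda+3456},$$ $R=\sqrt{a_4\Delta t^6\lambda^4+a_3\Delta t^4\lambda^3+a_2\Delta t^2\lambda^2+a_1\lambda}$ (complex square root), $a_4=144a^2-24a+1$, $a_3=1728a^2+720a-144$, $a_2=5184a^2+3456$, $a_1=-20736$. *)

theory Defs
  imports "HOL-Analysis.Analysis"
begin

text \<open>Slabs are indexed by integers, since \<open>u_ex\<close> at \<open>n = 0\<close> and the reference slab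
  below use the time \<open>t_{-1} = - dt\<close>.\<close>

definition tm :: "real \<Rightarrow> int \<Rightarrow> real" where
  "tm dt n = of_int n * dt"

definition node :: "real \<Rightarrow> int \<Rightarrow> 3 \<Rightarrow> real" where
  "node dt n i =
     (if i = 1 then tm dt (n - 1)
      else if i = 2 then (tm dt (n - 1) + tm dt n) / 2
      else tm dt n)"

text \<open>The basis functions are polynomials on the whole line, so that their one-sided limits
  (and those of their derivatives) at the end points of the slab \<open>(t_{n-1}, t_n]\<close> are just values
  there.\<close>

definition psi :: "real \<Rightarrow> int \<Rightarrow> 3 \<Rightarrow> real \<Rightarrow> real" where
  "psi dt n j t = (\<Prod>k \<in> UNIV - {j}. (t - node dt n k) / (node dt n j - node dt n k))"

definition A_minus :: "real \<Rightarrow> real \<Rightarrow> real \<Rightarrow> int \<Rightarrow> real^3^3" where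
  "A_minus dt lam s n = (\<chi> i j.
     - (1 + s / 2 * lam) * deriv (psi dt n j) (tm dt n) * deriv (psi dt (n + 1) i) (tm dt n)
     - lam * psi dt n j (tm dt n) * psi dt (n + 1) i (tm dt n))"

definition A_plus :: "real \<Rightarrow> real \<Rightarrow> real \<Rightarrow> int \<Rightarrow> real^3^3" where
  "A_plus dt lam s n = (\<chi> i j.
     integral {tm dt n..tm dt (n + 1)}
       (\<lambda>t. deriv (deriv (psi dt (n + 1) j)) t * deriv (psi dt (n + 1) i) t)
     + lam * integral {tm dt n..tm dt (n + 1)}
       (\<lambda>t. psi dt (n + 1) j t * deriv (psi dt (n + 1) i) t)
     + (1 - s / 2 * lam) * deriv (psi dt (n + 1) j) (tm dt n) * deriv (psi dt (n + 1) i) (tm dt n)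
     + lam * psi dt (n + 1) j (tm dt n) * psi dt (n + 1) i (tm dt n))"

lemma psi_shift: "psi dt n j t = psi dt 0 j (t - tm dt n)"
proof -
  have "node dt n k = node dt 0 k + tm dt n" for k
    by (simp add: node_def tm_def field_simps)
  then show ?thesis
    by (simp add: psi_def algebra_simps)
qed

lemma deriv_shift: "deriv (\<lambda>t. f (t - c)) = (\<lambda>t. deriv f (t - c))" for f :: "real \<Rightarrow> real"
proof
  fix t
  have "((\<lambda>t. f (t - c)) has_field_derivative D) (at t)
      \<longleftrightarrow> (f has_field_derivative D) (at (t - c))" for D
    using DERIV_shift[of f D t "- c"] by simp
  then show "deriv (\<lambda>t. f (t - c)) t = deriv f (t - c)"
    by (simp add: deriv_def)
qed

lemma integral_shift_slab:
  "integral {tm dt n..tm dt (n + 1)} (\<lambda>t. f (t - tm dt n)) = integral {0..dt} f"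
  for f :: "real \<Rightarrow> real"
proof -
  have "tm dt (n + 1) = dt + tm dt n"
    by (simp add: tm_def algebra_simps)
  then show ?thesis
    using integral_shift_real_ivl[where f = f and a = 0 and b = dt and c = "- tm dt n"] by simp
qed

lemma psi_shift1: "psi dt n j = (\<lambda>t. psi dt 0 j (t - tm dt n))"
  by (rule ext) (rule psi_shift)

lemma psi_next: "psi dt (n + 1) j = (\<lambda>t. psi dt 1 j (t - tm dt n))"
proof
  fix t
  have "t - tm dt (n + 1) = t - tm dt n - tm dt 1"
    by (simp add: tm_def algebra_simps)
  then show "psi dt (n + 1) j t = psi dt 1 j (t - tm dt n)"
    by (metis psi_shift)
qed

lemma deriv_psi_shift: "deriv (psi dt n j) t = deriv (psi dt 0 j) (t - tm dt n)"
  unfolding psi_shift1[of dt n] by (simp only: deriv_shift[of "psi dt 0 j" "tm dt n"])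

lemma deriv_psi_next: "deriv (psi dt (n + 1) j) = (\<lambda>t. deriv (psi dt 1 j) (t - tm dt n))"
  by (simp only: psi_next deriv_shift[of "psi dt 1 j" "tm dt n"])

lemma deriv2_psi_next:
  "deriv (deriv (psi dt (n + 1) j)) = (\<lambda>t. deriv (deriv (psi dt 1 j)) (t - tm dt n))"
  by (simp only: deriv_psi_next deriv_shift[of "deriv (psi dt 1 j)" "tm dt n"])

lemma A_minus_indep: "A_minus dt lam s n = A_minus dt lam s 0"
proof -
  have "A_minus dt lam s n = (\<chi> i j.
     - (1 + s / 2 * lam) * deriv (psi dt 0 j) 0 * deriv (psi dt 1 i) 0
     - lam * psi dt 0 j 0 * psi dt 1 i 0)" for n
  proof -
    have "psi dt n j (tm dt n) = psi dt 0 j 0" for j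
      by (simp only: psi_shift[of dt n] diff_self)
    moreover have "deriv (psi dt n j) (tm dt n) = deriv (psi dt 0 j) 0" for j
      by (simp only: deriv_psi_shift[of dt n] diff_self)
    ultimately show ?thesis
      unfolding A_minus_def deriv_psi_next unfolding psi_next by (simp only: diff_self)
  qed
  from this[of n] this[of 0] show ?thesis
    by (simp only:)
qed

lemma A_plus_indep: "A_plus dt lam s n = A_plus dt lam s 0"
proof -
  have "A_plus dt lam s n = (\<chi> i j.
     integral {0..dt} (\<lambda>t. deriv (deriv (psi dt 1 j)) t * deriv (psi dt 1 i) t)
     + lam * integral {0..dt} (\<lambda>t. psi dt 1 j t * deriv (psi dt 1 i) t)
     + (1 - s / 2 * lam) * deriv (psi dt 1 j) 0 * deriv (psi dt 1 i) 0
     + lam * psi dt 1 j 0 * psi dt 1 i 0)" for n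
  proof -
    have "integral {tm dt n..tm dt (n + 1)}
        (\<lambda>t. deriv (deriv (psi dt (n + 1) j)) t * deriv (psi dt (n + 1) i) t) =
      integral {0..dt} (\<lambda>t. deriv (deriv (psi dt 1 j)) t * deriv (psi dt 1 i) t)" for i j
      unfolding deriv2_psi_next unfolding deriv_psi_next by (rule integral_shift_slab)
    moreover have "integral {tm dt n..tm dt (n + 1)}
        (\<lambda>t. psi dt (n + 1) j t * deriv (psi dt (n + 1) i) t) =
      integral {0..dt} (\<lambda>t. psi dt 1 j t * deriv (psi dt 1 i) t)" for i j
      unfolding deriv_psi_next unfolding psi_next by (rule integral_shift_slab)
    ultimately show ?thesis
      by (simp only: A_plus_def) (simp only: deriv_psi_next[THEN fun_cong] psi_next[THEN fun_cong] diff_self)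
  qed
  from this[of n] this[of 0] show ?thesis
    by (simp only:)
qed

text \<open>The slab index \<open>0\<close> is no restriction, by \<open>A_minus_indep\<close> and \<open>A_plus_indep\<close>.\<close>

definition G_mat :: "real \<Rightarrow> real \<Rightarrow> real \<Rightarrow> real^3^3" where
  "G_mat dt lam a =
     - (matrix_inv (A_plus dt lam (a * dt^2) 0) ** A_minus dt lam (a * dt^2) 0)"

definition u_ex :: "real \<Rightarrow> (real \<Rightarrow> real) \<Rightarrow> nat \<Rightarrow> real^3" where
  "u_ex dt u n = (\<chi> i. u (node dt (int n) i))"

definition theta :: "real \<Rightarrow> real \<Rightarrow> real \<Rightarrow> (real \<Rightarrow> real) \<Rightarrow> nat \<Rightarrow> real^3" where
  "theta dt lam a u n = u_ex dt u (n + 1) - G_mat dt lam a *v u_ex dt u n"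

definition R_root :: "real \<Rightarrow> real \<Rightarrow> real \<Rightarrow> complex" where
  "R_root dt lam a = csqrt (complex_of_real
     ((144 * a^2 - 24 * a + 1) * dt^6 * lam^4
      + (1728 * a^2 + 720 * a - 144) * dt^4 * lam^3
      + (5184 * a^2 + 3456) * dt^2 * lam^2
      + (-20736) * lam))"

text \<open>The sign \<open>\<sigma>\<close> is \<open>1\<close> for the first and \<open>-1\<close> for the second of the two values.\<close>

definition eigval :: "real \<Rightarrow> real \<Rightarrow> real \<Rightarrow> complex \<Rightarrow> complex" where
  "eigval dt lam a \<sigma> =
     (complex_of_real ((6 * a - 1) * dt^4 * lam^2 + 60 * dt^2 * lam - 144)
      + \<sigma> * complex_of_real dt * R_root dt lam a)
     / complex_of_real ((18 * a - 2) * dt^4 * lam^2 + (72 * a - 12) * dt^2 * lam - 144)"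

definition eighat :: "real \<Rightarrow> real \<Rightarrow> real \<Rightarrow> complex \<Rightarrow> complex" where
  "eighat dt lam a \<sigma> =
     (complex_of_real ((1 - 6 * a) * dt^6 * lam^3 - (288 * a + 24) * dt^4 * lam^2
        - (864 * a + 432) * dt^2 * lam + 3456)
      - \<sigma> * complex_of_real (dt^3 * lam + 12 * dt) * R_root dt lam a)
     / complex_of_real ((36 * a - 4) * dt^6 * lam^3 + (24 - 288 * a) * dt^4 * lam^2
        - 1728 * a * dt^2 * lam + 3456)"

definition D_mat :: "real \<Rightarrow> real \<Rightarrow> real \<Rightarrow> complex^3^3" where
  "D_mat dt lam a = vector [
     vector [0, 0, 0],
     vector [0, eigval dt lam a 1, 0],
     vector [0, 0, eigval dt lam a (- 1)]]"

definition W_mat :: "real \<Rightarrow> real \<Rightarrow> real \<Rightarrow> complex^3^3" where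
  "W_mat dt lam a = vector [
     vector [1, 1, 1],
     vector [1 / 4, eighat dt lam a 1, eighat dt lam a (- 1)],
     vector [0, eigval dt lam a 1, eigval dt lam a (- 1)]]"

definition cvec :: "real^3 \<Rightarrow> complex^3" where
  "cvec x = (\<chi> i. complex_of_real (x $ i))"

definition cmat :: "real^3^3 \<Rightarrow> complex^3^3" where
  "cmat M = (\<chi> i j. complex_of_real (M $ i $ j))"

end

theory Submission
  imports Defs
begin

text \<open>Time derivatives scale like \<open>1 / h\<close> with the step size \<open>h\<close>, so the iteration matrix is a rational
  function of \<open>x = lam * h^2\<close> and \<open>a\<close> (\<open>G_mat_eq\<close>). The stated eigenvalues and eigenvectors are then
  verified by polynomial identities in which the square root occurs only through its square
  (\<open>eigen_identity\<close>, \<open>G_mat_W_mat\<close>).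

  Taylor expansion of the exact solution shows that the local error \<open>theta\<close> is \<open>O(h^3)\<close>
  (\<open>unif_bigo_residual\<close>, \<open>unif_bigo_theta\<close>). The two nonzero eigenvalues are
  \<open>1 \<minusplus> \<i> * sqrt lam * h\<close> to first order, and their eigenvectors merge as \<open>h\<close> tends to \<open>0\<close>. The inverse
  of the eigenvector matrix therefore grows like \<open>1 / h\<close> and may cost one power of \<open>h\<close>. Solving for the
  coefficients explicitly (\<open>matrix_inv_W_mat_apply\<close>) shows that this power is lost on a single linear
  combination of the components of \<open>theta\<close>, to leading order \<open>theta_2 - 3/4 * theta_3\<close>. The \<open>h^3\<close> term
  of that combination is proportional to \<open>a\<close>. For \<open>a = 0\<close> the combination is \<open>O(h^4)\<close>, and nothing is
  lost (\<open>unif_bigo_residual_combination\<close>, \<open>unif_bigo_W_inverse_theta\<close>).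

  For the global error one passes to eigenvector coordinates. The eigenvalues have modulus at most
  \<open>1 + K * h\<close>, so their powers stay bounded over the \<open>T / h\<close> steps and the accumulated error is one order
  lower than the transformed local error (\<open>error_bound\<close>); the eigenvector matrix is bounded, so going
  back does not change the order.\<close>

section \<open>The scheme on a slab as a function of \<open>lam * h^2\<close>\<close>

text \<open>A function on the three nodes of a slab, given by its values there; it also serves to list the
  coefficients of the three basis functions.\<close>
definition nodal :: "'a \<Rightarrow> 'a \<Rightarrow> 'a \<Rightarrow> 3 \<Rightarrow> 'a" where
  "nodal p q r i = (if i = 1 then p else if i = 2 then q else r)"

lemma nodal_simps [simp]:
  "nodal p q r 1 = p" "nodal p q r 2 = q" "nodal p q r 3 = r"
  by (simp_all add: nodal_def)

definition quadratic :: "real \<Rightarrow> real \<Rightarrow> real \<Rightarrow> real \<Rightarrow> real" where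
  "quadratic c0 c1 c2 t = c0 + c1 * t + c2 * t^2"

lemma deriv_quadratic: "deriv (quadratic c0 c1 c2) = quadratic c1 (2 * c2) 0"
proof
  fix t
  have "(quadratic c0 c1 c2 has_real_derivative quadratic c1 (2 * c2) 0 t) (at t)"
    unfolding quadratic_def by (auto intro!: derivative_eq_intros)
  then show "deriv (quadratic c0 c1 c2) t = quadratic c1 (2 * c2) 0 t"
    by (rule DERIV_imp_deriv)
qed

lemma integral_quadratic_linear:
  assumes "h \<ge> 0"
  shows "integral {0..h} (\<lambda>t. quadratic c0 c1 c2 t * quadratic d0 d1 0 t) =
    c0 * d0 * h + (c0 * d1 + c1 * d0) * h^2 / 2 + (c1 * d1 + c2 * d0) * h^3 / 3 + c2 * d1 * h^4 / 4"
proof -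
  define F where "F t = c0 * d0 * t + (c0 * d1 + c1 * d0) * t^2 / 2
      + (c1 * d1 + c2 * d0) * t^3 / 3 + c2 * d1 * t^4 / 4" for t
  have "((\<lambda>t. quadratic c0 c1 c2 t * quadratic d0 d1 0 t) has_integral F h - F 0) {0..h}"
  proof (rule fundamental_theorem_of_calculus[OF assms])
    fix t
    have "(F has_real_derivative quadratic c0 c1 c2 t * quadratic d0 d1 0 t) (at t within {0..h})"
      unfolding quadratic_def F_def
      by (auto intro!: derivative_eq_intros simp: power2_eq_square power3_eq_cube field_simps)
    then show "(F has_vector_derivative quadratic c0 c1 c2 t * quadratic d0 d1 0 t) (at t within {0..h})"
      by (simp add: has_real_derivative_iff_has_vector_derivative)
  qed
  then show ?thesis
    by (simp add: integral_unique F_def)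
qed

lemma prod_other:
  fixes f :: "3 \<Rightarrow> 'a::comm_monoid_mult"
  shows "prod f (UNIV - {1}) = f 2 * f 3" "prod f (UNIV - {2}) = f 1 * f 3"
    "prod f (UNIV - {3}) = f 1 * f 2"
proof -
  have distinct: "(1::3) \<noteq> 2" "(1::3) \<noteq> 3" "(2::3) \<noteq> 3"
    by simp_all
  have "UNIV - {1::3} = {2, 3}" "UNIV - {2::3} = {1, 3}" "UNIV - {3::3} = {1, 2}"
    unfolding UNIV_3 using distinct distinct[symmetric] by blast+
  then show "prod f (UNIV - {1}) = f 2 * f 3" "prod f (UNIV - {2}) = f 1 * f 3"
    "prod f (UNIV - {3}) = f 1 * f 2"
    using distinct by simp_all
qed

text \<open>In the variable \<open>t / h\<close> the nodes of the two slabs that meet at time \<open>0\<close> no longer depend on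
  the step size, so only the powers of \<open>h\<close> in front of the coefficients remain.\<close>
lemma psi_current:
  assumes "h \<noteq> 0"
  shows "psi h 0 j = quadratic (nodal 0 0 1 j) (nodal 1 (-4) 3 j / h) (nodal 2 (-4) 2 j / h^2)"
proof
  fix t
  define w where "w = t / h"
  have t: "t = h * w"
    using assms by (simp add: w_def)
  have node: "node h 0 k = h * nodal (-1) (-1/2) 0 k" for k
    by (simp add: node_def tm_def nodal_def)
  have "psi h 0 j t = (\<Prod>k \<in> UNIV - {j}. (w - nodal (-1) (-1/2) 0 k) / (nodal (-1) (-1/2) 0 j - nodal (-1) (-1/2) 0 k))"
    unfolding psi_def t node right_diff_distrib[symmetric] using assms by simp
  also have "\<dots> = quadratic (nodal 0 0 1 j) (nodal 1 (-4) 3 j) (nodal 2 (-4) 2 j) w"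
  proof -
    have "j = 1 \<or> j = 2 \<or> j = 3"
      by (rule exhaust_3)
    then show ?thesis
      by (elim disjE; hypsubst)
        (simp_all only: prod_other nodal_simps, simp_all add: quadratic_def power2_eq_square algebra_simps)
  qed
  finally show "psi h 0 j t = quadratic (nodal 0 0 1 j) (nodal 1 (-4) 3 j / h) (nodal 2 (-4) 2 j / h^2) t"
    by (simp add: quadratic_def w_def power_divide)
qed

lemma psi_next_slab:
  assumes "h \<noteq> 0"
  shows "psi h 1 j = quadratic (nodal 1 0 0 j) (nodal (-3) 4 (-1) j / h) (nodal 2 (-4) 2 j / h^2)"
proof
  fix t
  define w where "w = t / h"
  have t: "t = h * w"
    using assms by (simp add: w_def)
  have node: "node h 1 k = h * nodal 0 (1/2) 1 k" for k
    by (simp add: node_def tm_def nodal_def)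
  have "psi h 1 j t = (\<Prod>k \<in> UNIV - {j}. (w - nodal 0 (1/2) 1 k) / (nodal 0 (1/2) 1 j - nodal 0 (1/2) 1 k))"
    unfolding psi_def t node right_diff_distrib[symmetric] using assms by simp
  also have "\<dots> = quadratic (nodal 1 0 0 j) (nodal (-3) 4 (-1) j) (nodal 2 (-4) 2 j) w"
  proof -
    have "j = 1 \<or> j = 2 \<or> j = 3"
      by (rule exhaust_3)
    then show ?thesis
      by (elim disjE; hypsubst)
        (simp_all only: prod_other nodal_simps, simp_all add: quadratic_def power2_eq_square algebra_simps)
  qed
  finally show "psi h 1 j t = quadratic (nodal 1 0 0 j) (nodal (-3) 4 (-1) j / h) (nodal 2 (-4) 2 j / h^2) t"
    by (simp add: quadratic_def w_def power_divide)
qed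

text \<open>The two assembled matrices times \<open>h^2\<close>. A time derivative costs a factor \<open>1 / h\<close>, and \<open>lam\<close>
  and \<open>s * lam\<close> turn into \<open>lam * h^2\<close> and \<open>a * (lam * h^2)\<close>; so step size and stiffness enter only
  through the number \<open>x = lam * h^2\<close>.\<close>
definition A_plus_scaled :: "real \<Rightarrow> real \<Rightarrow> real^3^3" where
  "A_plus_scaled a x = vector [
     vector [5 + x/2 - 9/2*a*x, -4 - 2/3*x + 6*a*x, -1 + x/6 - 3/2*a*x],
     vector [-12 + 2/3*x + 6*a*x, 16 - 8*a*x, -4 - 2/3*x + 2*a*x],
     vector [7 - x/6 - 3/2*a*x, -12 + 2/3*x + 2*a*x, 5 + x/2 - a*x/2]]"

definition A_minus_scaled :: "real \<Rightarrow> real \<Rightarrow> real^3^3" where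
  "A_minus_scaled a x = vector [
     vector [3 + 3/2*a*x, -12 - 6*a*x, 9 - x + 9/2*a*x],
     vector [-4 - 2*a*x, 16 + 8*a*x, -12 - 6*a*x],
     vector [1 + a*x/2, -4 - 2*a*x, 3 + 3/2*a*x]]"

lemma A_plus_entry:
  fixes i j :: 3
  defines "c0 \<equiv> nodal 1 0 0 j" and "c1 \<equiv> nodal (-3) 4 (-1) j" and "c2 \<equiv> nodal 2 (-4) 2 j"
    and "d0 \<equiv> nodal 1 0 0 i" and "d1 \<equiv> nodal (-3) 4 (-1) i" and "d2 \<equiv> nodal 2 (-4) 2 i"
  assumes "h > 0"
  shows "A_plus h lam (a * h^2) 0 $ i $ j =
    (2 * c2 * d1 + 2 * c2 * d2
     + lam * h^2 * (c0 * d1 + (2 * c0 * d2 + c1 * d1) / 2 + (2 * c1 * d2 + c2 * d1) / 3 + c2 * d2 / 2)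
     + (1 - a * (lam * h^2) / 2) * c1 * d1 + lam * h^2 * c0 * d0) / h^2"
proof -
  have "A_plus h lam (a * h^2) 0 $ i $ j =
      integral {0..h} (\<lambda>t. quadratic (2 * (c2 / h^2)) 0 0 t * quadratic (d1 / h) (2 * (d2 / h^2)) 0 t)
      + lam * integral {0..h} (\<lambda>t. quadratic c0 (c1 / h) (c2 / h^2) t * quadratic (d1 / h) (2 * (d2 / h^2)) 0 t)
      + (1 - a * h^2 / 2 * lam) * (c1 / h) * (d1 / h) + lam * c0 * d0"
    using assms(7)
    by (simp add: A_plus_def tm_def psi_next_slab deriv_quadratic c0_def c1_def c2_def d0_def d1_def d2_def)
      (simp add: quadratic_def)
  then show ?thesis
    using assms(7) by (simp add: integral_quadratic_linear) (simp add: field_simps eval_nat_numeral)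
qed

lemma A_minus_entry:
  fixes i j :: 3
  assumes "h > 0"
  shows "A_minus h lam (a * h^2) 0 $ i $ j =
    (- (1 + a * (lam * h^2) / 2) * nodal 1 (-4) 3 j * nodal (-3) 4 (-1) i
     - lam * h^2 * nodal 0 0 1 j * nodal 1 0 0 i) / h^2"
proof -
  have "A_minus h lam (a * h^2) 0 $ i $ j =
      - (1 + a * h^2 / 2 * lam) * (nodal 1 (-4) 3 j / h) * (nodal (-3) 4 (-1) i / h)
      - lam * nodal 0 0 1 j * nodal 1 0 0 i"
    using assms
    by (simp add: A_minus_def tm_def psi_next_slab psi_current deriv_quadratic)
      (simp add: quadratic_def)
  then show ?thesis
    using assms by (simp add: field_simps eval_nat_numeral)
qed

lemma A_plus_eq:
  assumes "h > 0"
  shows "A_plus h lam (a * h^2) 0 = (1 / h^2) *\<^sub>R A_plus_scaled a (lam * h^2)"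
proof -
  have "\<forall>i j. A_plus h lam (a * h^2) 0 $ i $ j = A_plus_scaled a (lam * h^2) $ i $ j / h^2"
    unfolding forall_3 A_plus_entry[OF assms] A_plus_scaled_def vector_3 nodal_simps
    by (intro conjI arg_cong2[where f = divide] refl; simp; algebra)
  then show ?thesis
    by (simp add: vec_eq_iff)
qed

lemma A_minus_eq:
  assumes "h > 0"
  shows "A_minus h lam (a * h^2) 0 = (1 / h^2) *\<^sub>R A_minus_scaled a (lam * h^2)"
proof -
  have "\<forall>i j. A_minus h lam (a * h^2) 0 $ i $ j = A_minus_scaled a (lam * h^2) $ i $ j / h^2"
    unfolding forall_3 A_minus_entry[OF assms] A_minus_scaled_def vector_3 nodal_simps
    by (intro conjI arg_cong2[where f = divide] refl; simp add: algebra_simps)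
  then show ?thesis
    by (simp add: vec_eq_iff)
qed

lemma matrix_inv_left:
  assumes "invertible A"
  shows "matrix_inv A ** A = mat 1"
  using assms unfolding invertible_def matrix_inv_def by (rule someI2_ex) simp

text \<open>The denominator of the eigenvalues. Up to the factor \<open>- 2 / 9 * x\<close> it is also the determinant
  of \<open>A_plus_scaled\<close>; the entries of its adjugate times
  \<open>A_minus_scaled\<close> share that \<open>x\<close>, and so the iteration
  matrix stays bounded although \<open>A_plus_scaled\<close> degenerates as the step size tends to \<open>0\<close>.\<close>
definition eig_den :: "'a \<Rightarrow> 'a \<Rightarrow> 'a::comm_ring_1" where
  "eig_den a x = (18 * a - 2) * x^2 + (72 * a - 12) * x - 144"

text \<open>The iteration matrix times \<open>eig_den a x\<close>.\<close>
definition G_num :: "real \<Rightarrow> real \<Rightarrow> real^3^3" where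
  "G_num a x = vector [
     vector [0, 0, eig_den a x],
     vector [-72 - 6*x - 36*a*x - 3*a*x^2, 288 + 24*x + 144*a*x + 12*a*x^2, -360 - 12*x - 36*a*x + x^2],
     vector [-144 + 12*x - 72*a*x + 6*a*x^2, 576 - 48*x + 288*a*x - 24*a*x^2, -576 + 96*x - 144*a*x - 2*x^2]]"

lemma det_A_plus_scaled: "det (A_plus_scaled a x) = - 2 / 9 * x * eig_den a x"
  by (simp add: det_3 A_plus_scaled_def eig_den_def) algebra

lemma A_plus_scaled_G_num: "A_plus_scaled a x ** G_num a x = - (eig_den a x *\<^sub>R A_minus_scaled a x)"
proof -
  have "\<forall>i j. (A_plus_scaled a x ** G_num a x) $ i $ j = - (eig_den a x * A_minus_scaled a x $ i $ j)"
    unfolding forall_3 matrix_matrix_mult_def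
    by (simp add: sum_3 A_plus_scaled_def G_num_def A_minus_scaled_def eig_den_def, simp add: algebra_simps power2_eq_square)
  then show ?thesis
    by (simp add: vec_eq_iff)
qed

lemma invertible_A_plus:
  assumes "h > 0" "lam > 0" "eig_den a (lam * h^2) \<noteq> 0"
  shows "invertible (A_plus h lam (a * h^2) 0)"
proof -
  have "det (A_plus_scaled a (lam * h^2)) \<noteq> 0"
    using assms by (simp add: det_A_plus_scaled)
  then have "invertible (A_plus_scaled a (lam * h^2))"
    by (simp add: invertible_det_nz)
  then show ?thesis
    unfolding A_plus_eq[OF assms(1)] using assms(1) by (intro scalar_invertible) auto
qed

lemma G_mat_eq:
  assumes "h > 0" "lam > 0" "eig_den a (lam * h^2) \<noteq> 0"
  shows "G_mat h lam a = (1 / eig_den a (lam * h^2)) *\<^sub>R G_num a (lam * h^2)"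
proof -
  let ?x = "lam * h^2" and ?P = "A_plus h lam (a * h^2) 0" and ?M = "A_minus h lam (a * h^2) 0"
  let ?G = "(1 / eig_den a ?x) *\<^sub>R G_num a ?x"
  have PG: "?P ** ?G = - ?M"
    unfolding A_plus_eq[OF assms(1)] A_minus_eq[OF assms(1)] using assms(3)
    by (simp add: matrix_scalar_ac A_plus_scaled_G_num flip: scalar_matrix_assoc)
  have "G_mat h lam a = matrix_inv ?P ** (- ?M)"
    by (simp add: G_mat_def matrix_matrix_mult_def vec_eq_iff sum_negf)
  also have "\<dots> = (matrix_inv ?P ** ?P) ** ?G"
    by (simp add: matrix_mul_assoc flip: PG)
  also have "\<dots> = ?G"
    using invertible_A_plus[OF assms] by (simp add: matrix_inv_left)
  finally show ?thesis .
qed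

section \<open>Eigenvalues and eigenvectors\<close>
lemma cvec_matrix_vector: "cvec (M *v y) = cmat M *v cvec y"
  by (simp add: cvec_def cmat_def matrix_vector_mult_def vec_eq_iff)

lemma norm_cvec: "norm (cvec y) = norm y"
  by (simp add: cvec_def norm_vec_def)

definition eig_mid_num :: "'a \<Rightarrow> 'a \<Rightarrow> 'a::comm_ring_1" where
  "eig_mid_num a x = (6 * a - 1) * x^2 + 60 * x - 144"

definition hat_mid_num :: "'a \<Rightarrow> 'a \<Rightarrow> 'a::comm_ring_1" where
  "hat_mid_num a x = (1 - 6 * a) * x^3 - (288 * a + 24) * x^2 - (864 * a + 432) * x + 3456"

definition disc :: "'a \<Rightarrow> 'a \<Rightarrow> 'a::comm_ring_1" where
  "disc a x = (144 * a^2 - 24 * a + 1) * x^4 + (1728 * a^2 + 720 * a - 144) * x^3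
     + (5184 * a^2 + 3456) * x^2 - 20736 * x"

text \<open>The eigenvalue pair is \<open>eig_mid \<plusminus> eig_half_gap\<close>, and the second components of the two eigenvectors
  are \<open>hat_mid \<minusplus> hat_slope * eig_half_gap\<close>. The complex square root sits in \<open>eig_half_gap\<close> alone. The
  denominator of the second components is \<open>(2 * x - 24) * eig_den a x\<close>, which leaves
  \<open>hat_slope = (x + 12) / (2 * x - 24)\<close>.\<close>
definition eig_mid :: "real \<Rightarrow> real \<Rightarrow> real" where
  "eig_mid a x = eig_mid_num a x / eig_den a x"

definition hat_mid :: "real \<Rightarrow> real \<Rightarrow> real" where
  "hat_mid a x = hat_mid_num a x / ((2 * x - 24) * eig_den a x)"

definition hat_slope :: "real \<Rightarrow> real" where
  "hat_slope x = (x + 12) / (2 * x - 24)"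

definition eig_half_gap :: "real \<Rightarrow> real \<Rightarrow> real \<Rightarrow> complex" where
  "eig_half_gap h lam a = complex_of_real h * R_root h lam a / complex_of_real (eig_den a (lam * h^2))"

lemma R_root_sq:
  "(complex_of_real h * R_root h lam a)^2 = disc (complex_of_real a) (complex_of_real (lam * h^2))"
  by (simp add: R_root_def power_mult_distrib disc_def) algebra

lemma eigval_eq:
  "eigval h lam a \<sigma> = complex_of_real (eig_mid a (lam * h^2)) + \<sigma> * eig_half_gap h lam a"
proof -
  have "(6 * a - 1) * h^4 * lam^2 + 60 * h^2 * lam - 144 = eig_mid_num a (lam * h^2)"
    "(18 * a - 2) * h^4 * lam^2 + (72 * a - 12) * h^2 * lam - 144 = eig_den a (lam * h^2)"
    by (simp_all add: eig_mid_num_def eig_den_def) algebra+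
  then show ?thesis
    by (simp only: eigval_def eig_mid_def eig_half_gap_def of_real_divide add_divide_distrib mult.assoc times_divide_eq_right)
qed

lemma eighat_eq:
  "eighat h lam a \<sigma> = complex_of_real (hat_mid a (lam * h^2))
     - \<sigma> * complex_of_real (hat_slope (lam * h^2)) * eig_half_gap h lam a"
proof -
  let ?x = "lam * h^2"
  have num: "(1 - 6 * a) * h^6 * lam^3 - (288 * a + 24) * h^4 * lam^2 - (864 * a + 432) * h^2 * lam + 3456
      = hat_mid_num a ?x"
    and den: "(36 * a - 4) * h^6 * lam^3 + (24 - 288 * a) * h^4 * lam^2 - 1728 * a * h^2 * lam + 3456
      = (2 * ?x - 24) * eig_den a ?x"
    and root: "h^3 * lam + 12 * h = (?x + 12) * h"
    by (simp_all add: hat_mid_num_def eig_den_def) algebra+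
  have "\<sigma> * complex_of_real ((?x + 12) * h) * R_root h lam a / complex_of_real ((2 * ?x - 24) * eig_den a ?x)
      = \<sigma> * complex_of_real (hat_slope ?x) * eig_half_gap h lam a"
    by (simp only: hat_slope_def eig_half_gap_def of_real_mult of_real_divide times_divide_times_eq
        times_divide_eq_right times_divide_eq_left mult.assoc divide_divide_eq_left)
  then show ?thesis
    by (simp only: eighat_def num den root hat_mid_def of_real_divide diff_divide_distrib)
qed

text \<open>The eigenvector equation with denominators cleared. Only the square of the root matters: the
  difference of the two sides is a multiple of \<open>\<rho>^2 - disc a x\<close>. Both signs of the root satisfy this,
  so one identity covers both eigenvectors.\<close>
lemma eigen_identity:
  fixes a x \<rho> :: complex
  assumes "\<rho>^2 = disc a x"
  defines "N \<equiv> eig_mid_num a x + \<rho>" and "V \<equiv> hat_mid_num a x - (x + 12) * \<rho>" and "k \<equiv> 2 * x - 24"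
  shows "(-72 - 6*x - 36*a*x - 3*a*x^2) * (k * eig_den a x) + (288 + 24*x + 144*a*x + 12*a*x^2) * V
      + (-360 - 12*x - 36*a*x + x^2) * (k * N) = N * V" (is "?L2 = _")
    and "(-144 + 12*x - 72*a*x + 6*a*x^2) * (k * eig_den a x) + (576 - 48*x + 288*a*x - 24*a*x^2) * V
      + (-576 + 96*x - 144*a*x - 2*x^2) * (k * N) = N * (k * N)" (is "?L3 = _")
proof -
  have "?L2 - N * V = (x + 12) * (\<rho>^2 - disc a x)" "?L3 - N * (k * N) = k * (disc a x - \<rho>^2)"
    unfolding assms(2-4) eig_mid_num_def hat_mid_num_def disc_def eig_den_def by algebra+
  then show "?L2 = N * V" "?L3 = N * (k * N)"
    using assms(1) by simp_all
qed

lemma G_mat_eigenvector: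
  fixes \<sigma> :: complex
  assumes "h > 0" "lam > 0" "lam * h^2 < 12" "eig_den a (lam * h^2) \<noteq> 0" "\<sigma>^2 = 1"
  shows "cmat (G_mat h lam a) *v vector [1, eighat h lam a \<sigma>, eigval h lam a \<sigma>] =
    eigval h lam a \<sigma> *s vector [1, eighat h lam a \<sigma>, eigval h lam a \<sigma>]"
proof -
  let ?x = "lam * h^2"
  define d where "d = complex_of_real (eig_den a ?x)"
  define k where "k = complex_of_real (2 * ?x - 24)"
  define \<rho> where "\<rho> = \<sigma> * (complex_of_real h * R_root h lam a)"
  \<comment> \<open>Numerators of the eigenvalue and of the second component, each with its share of the root.\<close>
  define N where "N = complex_of_real (eig_mid_num a ?x) + \<rho>"
  define V where "V = complex_of_real (hat_mid_num a ?x) - complex_of_real (?x + 12) * \<rho>"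
  have nz: "d \<noteq> 0" "k \<noteq> 0"
    unfolding d_def k_def of_real_eq_0_iff using assms by auto
  have L: "eigval h lam a \<sigma> = N / d"
    by (simp add: eigval_eq eig_mid_def eig_half_gap_def N_def \<rho>_def d_def add_divide_distrib)
  have Lhat: "eighat h lam a \<sigma> = V / (k * d)"
    by (simp add: eighat_eq hat_mid_def hat_slope_def eig_half_gap_def V_def \<rho>_def d_def k_def diff_divide_distrib mult_ac)
  have sq: "\<rho>^2 = disc (complex_of_real a) (complex_of_real ?x)"
    using assms(5) R_root_sq[of h lam a] by (simp add: \<rho>_def power_mult_distrib)
  have of_real: "complex_of_real (eig_mid_num a ?x) = eig_mid_num (complex_of_real a) (complex_of_real ?x)"
    "complex_of_real (hat_mid_num a ?x) = hat_mid_num (complex_of_real a) (complex_of_real ?x)"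
    "complex_of_real (eig_den a ?x) = eig_den (complex_of_real a) (complex_of_real ?x)"
    by (simp_all add: eig_mid_num_def hat_mid_num_def eig_den_def)
  let ?g = "\<lambda>i j. complex_of_real (G_num a ?x $ i $ j)"
  have "?g 2 1 * (k * d) + ?g 2 2 * V + ?g 2 3 * (k * N) = N * V"
    "?g 3 1 * (k * d) + ?g 3 2 * V + ?g 3 3 * (k * N) = N * (k * N)"
    using eigen_identity[OF sq] unfolding N_def V_def d_def k_def of_real
    by (simp_all add: G_num_def)
  moreover have "?g 1 1 * (k * d) + ?g 1 2 * V + ?g 1 3 * (k * N) = N * (k * d)"
    by (simp add: G_num_def d_def)
  moreover have "X1 / d * 1 + X2 / d * (V / (k * d)) + X3 / d * (N / d) = N / d * (Y / (k * d))"
    if "X1 * (k * d) + X2 * V + X3 * (k * N) = N * Y" for X1 X2 X3 Y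
  proof -
    have "X1 / d * 1 + X2 / d * (V / (k * d)) + X3 / d * (N / d) =
        (X1 * (k * d) + X2 * V + X3 * (k * N)) / (k * d * d)"
      using nz by (simp add: field_simps)
    then show ?thesis
      unfolding that by (simp add: mult_ac)
  qed
  moreover have "k * d / (k * d) = 1" "k * N / (k * d) = N / d"
    using nz by simp_all
  ultimately have "\<forall>i. (\<Sum>j\<in>UNIV. ?g i j / d * vector [1, V / (k * d), N / d] $ j) =
      N / d * vector [1, V / (k * d), N / d] $ i"
    unfolding forall_3 sum_3 vector_3 by metis
  then show ?thesis
    unfolding L Lhat G_mat_eq[OF assms(1,2,4)]
    by (simp add: vec_eq_iff matrix_vector_mult_def cmat_def d_def)
qed

text \<open>The vector \<open>(1, 1/4, 0)\<close> holds the nodal values of the quadratic \<open>(1 - \<xi>)^2\<close>, which vanishes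
  together with its derivative at the right end of the slab. The next slab sees only these two
  values.\<close>
lemma G_mat_kernel:
  assumes "h > 0" "lam > 0" "eig_den a (lam * h^2) \<noteq> 0"
  shows "cmat (G_mat h lam a) *v vector [1, 1 / 4, 0] = 0"
proof -
  have "\<forall>i. G_num a (lam * h^2) $ i $ 1 + G_num a (lam * h^2) $ i $ 2 / 4 = 0"
    unfolding forall_3 G_num_def by (simp add: add_divide_distrib diff_divide_distrib)
  moreover have "G_mat h lam a $ i $ 1 + G_mat h lam a $ i $ 2 / 4 =
      (G_num a (lam * h^2) $ i $ 1 + G_num a (lam * h^2) $ i $ 2 / 4) / eig_den a (lam * h^2)" for i
    unfolding G_mat_eq[OF assms] by (simp add: add_divide_distrib)
  ultimately have "G_mat h lam a $ i $ 1 + G_mat h lam a $ i $ 2 / 4 = 0" for i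
    by simp
  then have "complex_of_real (G_mat h lam a $ i $ 1 + G_mat h lam a $ i $ 2 / 4) = 0" for i
    by (simp only: of_real_0)
  then show ?thesis
    by (simp add: vec_eq_iff matrix_vector_mult_def cmat_def sum_3)
qed

lemma G_mat_W_mat:
  assumes "h > 0" "lam > 0" "lam * h^2 < 12" "eig_den a (lam * h^2) \<noteq> 0"
  shows "cmat (G_mat h lam a) ** W_mat h lam a = W_mat h lam a ** D_mat h lam a"
proof -
  let ?G = "cmat (G_mat h lam a)"
  note simps = vec_eq_iff forall_3 matrix_vector_mult_def sum_3
  have "(?G *v vector [1, 1 / 4, 0]) $ i = 0" for i
    using G_mat_kernel[OF assms(1,2,4)] by simp
  moreover have "(?G *v vector [1, eighat h lam a \<sigma>, eigval h lam a \<sigma>]) $ i =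
      (eigval h lam a \<sigma> *s vector [1, eighat h lam a \<sigma>, eigval h lam a \<sigma>]) $ i" if "\<sigma>^2 = 1" for i \<sigma>
    using G_mat_eigenvector[OF assms that] by simp
  ultimately show ?thesis
    by (simp add: vec_eq_iff forall_3 matrix_matrix_mult_def matrix_vector_mult_def sum_3 W_mat_def D_mat_def)
qed

text \<open>As \<open>h\<close> tends to \<open>0\<close> both eigenvalues tend to \<open>1\<close> and the two eigenvectors merge. The determinant
  of the eigenvector matrix isolates this: it is \<open>2 * eig_half_gap\<close>, of exact order \<open>h\<close>, times
  a factor that tends to \<open>- 1 / 4\<close>.\<close>
definition W_det_factor :: "real \<Rightarrow> real \<Rightarrow> real" where
  "W_det_factor a x = 1 / 4 - hat_mid a x - hat_slope x * eig_mid a x"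

lemma det_W_mat: "det (W_mat h lam a) = 2 * eig_half_gap h lam a * complex_of_real (W_det_factor a (lam * h^2))"
  by (simp add: det_3 W_mat_def eigval_eq eighat_eq W_det_factor_def) (simp add: field_simps)

text \<open>The division by the gap, which costs a power of \<open>h\<close>, concerns just the difference \<open>m\<close> of the two
  oscillatory coefficients. Hence only one linear combination of the components \<open>v2\<close> and \<open>v3\<close>
  decides which order is lost.\<close>
lemma matrix_inv_W_mat_apply:
  fixes v2 v3 :: complex
  assumes "eig_half_gap h lam a \<noteq> 0" "W_det_factor a (lam * h^2) \<noteq> 0"
  defines "A \<equiv> complex_of_real (eig_mid a (lam * h^2))" and "A' \<equiv> complex_of_real (hat_mid a (lam * h^2))"
    and "\<kappa> \<equiv> complex_of_real (hat_slope (lam * h^2))" and "\<delta> \<equiv> complex_of_real (W_det_factor a (lam * h^2))"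
  defines "c \<equiv> (v2 + \<kappa> * v3) / \<delta>" and "m \<equiv> (A * v2 + (1 / 4 - A') * v3) / (\<delta> * eig_half_gap h lam a)"
  shows "matrix_inv (W_mat h lam a) *v vector [0, v2, v3] = vector [c, (m - c) / 2, (- m - c) / 2]"
proof -
  let ?W = "W_mat h lam a" and ?B = "eig_half_gap h lam a"
  have nz: "?B \<noteq> 0" "\<delta> \<noteq> 0"
    using assms(1,2) by (auto simp: \<delta>_def)
  have \<delta>: "\<delta> = 1 / 4 - A' - \<kappa> * A"
    by (simp add: \<delta>_def W_det_factor_def A_def A'_def \<kappa>_def)
  have c: "c * \<delta> = v2 + \<kappa> * v3" and m: "m * ?B * \<delta> = A * v2 + (1 / 4 - A') * v3"
    using nz by (simp_all add: c_def m_def)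
  have "(c * (1/4 - A') - \<kappa> * (m * ?B)) * \<delta> = v2 * \<delta>" "(m * ?B - A * c) * \<delta> = v3 * \<delta>"
    using c m unfolding \<delta> by algebra+
  then have v: "v2 = c * (1/4 - A') - \<kappa> * (m * ?B)" "v3 = m * ?B - A * c"
    using nz by simp_all
  have "c / 4 + (A' - \<kappa> * ?B) * (m - c) / 2 + (A' + \<kappa> * ?B) * (- m - c) / 2 = v2"
    "(A + ?B) * (m - c) / 2 + (A - ?B) * (- m - c) / 2 = v3"
    "c + (m - c) / 2 + (- m - c) / 2 = 0"
    unfolding v by (simp_all add: field_simps)
  then have "?W *v vector [c, (m - c) / 2, (- m - c) / 2] = vector [0, v2, v3]"
    by (simp add: vec_eq_iff forall_3 matrix_vector_mult_def sum_3 W_mat_def eigval_eq eighat_eq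
        flip: A_def A'_def \<kappa>_def)
  moreover have "invertible ?W"
    using assms(1,2) by (simp add: invertible_det_nz det_W_mat)
  ultimately show ?thesis
    by (metis matrix_inv_left matrix_vector_mul_assoc matrix_vector_mul_lid)
qed

section \<open>Orders in the step size, uniformly over an index\<close>

text \<open>The index is a time step, a time, or a dummy when the function depends on \<open>h\<close> only.\<close>
definition unif_bigo :: "nat \<Rightarrow> (real \<Rightarrow> 'i \<Rightarrow> 'b::real_normed_vector) \<Rightarrow> bool" where
  "unif_bigo k f \<longleftrightarrow> (\<exists>C. \<forall>\<^sub>F h in at_right 0. \<forall>i. norm (f h i) \<le> C * h^k)"

lemma eventually_pos: "\<forall>\<^sub>F h in at_right (0::real). h > 0"
  by (rule eventually_at_right_less)

lemma unif_bigoE: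
  assumes "unif_bigo k f"
  obtains C where "C \<ge> 0" "\<forall>\<^sub>F h in at_right 0. 0 < h \<and> (\<forall>i. norm (f h i) \<le> C * h^k)"
proof -
  from assms obtain C where C: "\<forall>\<^sub>F h in at_right 0. \<forall>i. norm (f h i) \<le> C * h^k"
    unfolding unif_bigo_def by blast
  have "\<forall>\<^sub>F h in at_right 0. 0 < h \<and> (\<forall>i. norm (f h i) \<le> \<bar>C\<bar> * h^k)"
    using C eventually_pos
  proof eventually_elim
    case (elim h)
    then have "C * h^k \<le> \<bar>C\<bar> * h^k"
      by (intro mult_right_mono) auto
    with elim show ?case
      by (meson order_trans)
  qed
  then show ?thesis
    by (intro that[of "\<bar>C\<bar>"]) auto
qed

lemma unif_bigo_cong:
  assumes "unif_bigo k g" "\<forall>\<^sub>F h in at_right 0. \<forall>i. f h i = g h i"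
  shows "unif_bigo k f"
proof -
  from assms(1) obtain C where "\<forall>\<^sub>F h in at_right 0. \<forall>i. norm (g h i) \<le> C * h^k"
    unfolding unif_bigo_def by blast
  with assms(2) have "\<forall>\<^sub>F h in at_right 0. \<forall>i. norm (f h i) \<le> C * h^k"
    by eventually_elim auto
  then show ?thesis
    unfolding unif_bigo_def by blast
qed

lemma unif_bigo_reindex:
  "unif_bigo k f \<Longrightarrow> unif_bigo k (\<lambda>h j. f h (r h j))"
  unfolding unif_bigo_def by (auto elim!: eventually_mono)

lemma unif_bigo_add:
  assumes "unif_bigo k f" "unif_bigo k g"
  shows "unif_bigo k (\<lambda>h i. f h i + g h i)"
proof -
  obtain C where C0: "C \<ge> 0" and C: "\<forall>\<^sub>F h in at_right 0. 0 < h \<and> (\<forall>i. norm (f h i) \<le> C * h^k)"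
    by (rule unif_bigoE[OF assms(1)])
  obtain D where D0: "D \<ge> 0" and D: "\<forall>\<^sub>F h in at_right 0. 0 < h \<and> (\<forall>i. norm (g h i) \<le> D * h^k)"
    by (rule unif_bigoE[OF assms(2)])
  have "\<forall>\<^sub>F h in at_right 0. \<forall>i. norm (f h i + g h i) \<le> (C + D) * h^k"
    using C D
  proof eventually_elim
    case (elim h)
    then show ?case
      by (auto simp: distrib_right intro!: norm_triangle_mono)
  qed
  then show ?thesis
    unfolding unif_bigo_def by blast
qed

lemma unif_bigo_minus: "unif_bigo k f \<Longrightarrow> unif_bigo k (\<lambda>h i. - f h i)"
  by (simp add: unif_bigo_def)

lemma unif_bigo_diff:
  "unif_bigo k f \<Longrightarrow> unif_bigo k g \<Longrightarrow> unif_bigo k (\<lambda>h i. f h i - g h i)"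
  using unif_bigo_add[of k f "\<lambda>h i. - g h i"] by (simp add: unif_bigo_minus)

lemma unif_bigo_mult:
  fixes f g :: "real \<Rightarrow> 'i \<Rightarrow> 'b::real_normed_algebra"
  assumes "unif_bigo k f" "unif_bigo l g"
  shows "unif_bigo (k + l) (\<lambda>h i. f h i * g h i)"
proof -
  obtain C where C0: "C \<ge> 0" and C: "\<forall>\<^sub>F h in at_right 0. 0 < h \<and> (\<forall>i. norm (f h i) \<le> C * h^k)"
    by (rule unif_bigoE[OF assms(1)])
  obtain D where D0: "D \<ge> 0" and D: "\<forall>\<^sub>F h in at_right 0. 0 < h \<and> (\<forall>i. norm (g h i) \<le> D * h^l)"
    by (rule unif_bigoE[OF assms(2)])
  have "\<forall>\<^sub>F h in at_right 0. \<forall>i. norm (f h i * g h i) \<le> (C * D) * h^(k + l)"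
    using C D
  proof eventually_elim
    case (elim h)
    have "norm (f h i * g h i) \<le> (C * h^k) * (D * h^l)" for i
      using elim C0 by (intro order_trans[OF norm_mult_ineq] mult_mono) auto
    then show ?case
      by (simp add: power_add mult_ac)
  qed
  then show ?thesis
    unfolding unif_bigo_def by blast
qed

lemma unif_bigo_mono:
  assumes "unif_bigo l f" "k \<le> l"
  shows "unif_bigo k f"
proof -
  obtain C where C0: "C \<ge> 0" and C: "\<forall>\<^sub>F h in at_right 0. 0 < h \<and> (\<forall>i. norm (f h i) \<le> C * h^l)"
    by (rule unif_bigoE[OF assms(1)])
  have "\<forall>\<^sub>F h in at_right (0::real). h < 1"
    by (rule eventually_at_rightI[of 0 1]) auto
  with C have "\<forall>\<^sub>F h in at_right 0. \<forall>i. norm (f h i) \<le> C * h^k"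
  proof eventually_elim
    case (elim h)
    then have "C * h^l \<le> C * h^k"
      using C0 assms(2) by (intro mult_left_mono power_decreasing) auto
    with elim show ?case
      by (meson order_trans)
  qed
  then show ?thesis
    unfolding unif_bigo_def by blast
qed

lemma unif_bigo_step_power: "unif_bigo k (\<lambda>h i. h^k)"
  unfolding unif_bigo_def
  by (intro exI[of _ 1] eventually_mono[OF eventually_pos]) auto

lemma unif_bigo_bounded:
  "(\<And>i. norm (f i) \<le> C) \<Longrightarrow> unif_bigo 0 (\<lambda>h. f)"
  unfolding unif_bigo_def by (intro exI[of _ C]) auto

text \<open>Continuity is required of the norm only, because the principal square root jumps across the
  negative real axis, where the argument of \<open>R_root\<close> lies for small \<open>h\<close>.\<close>
lemma unif_bigo_cont_norm:
  assumes "isCont (\<lambda>h. norm (f h)) 0"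
  shows "unif_bigo 0 (\<lambda>h i. f h)"
proof -
  have "((\<lambda>h. norm (f h)) \<longlongrightarrow> norm (f 0)) (at_right 0)"
    using assms unfolding isCont_def by (rule tendsto_within_subset) simp
  then have "\<forall>\<^sub>F h in at_right 0. norm (f h) < norm (f 0) + 1"
    by (rule order_tendstoD) simp
  then show ?thesis
    unfolding unif_bigo_def by (intro exI[of _ "norm (f 0) + 1"]) (auto elim!: eventually_mono)
qed

lemma unif_bigo_cont: "isCont f 0 \<Longrightarrow> unif_bigo 0 (\<lambda>h i. f h)"
  by (intro unif_bigo_cont_norm continuous_norm)

lemma unif_bigo_of_real:
  "unif_bigo k f \<Longrightarrow> unif_bigo k (\<lambda>h i. of_real (f h i) :: 'b::real_normed_algebra_1)"
  by (simp add: unif_bigo_def)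

lemma unif_bigo_coeff:
  assumes "isCont c 0" "unif_bigo k f"
  shows "unif_bigo k (\<lambda>h i. c h * f h i :: 'b::real_normed_algebra)"
  using unif_bigo_mult[OF unif_bigo_cont[OF assms(1)] assms(2)] by simp

lemma unif_bigo_divide_step:
  assumes "unif_bigo (Suc k) f"
  shows "unif_bigo k (\<lambda>h i. f h i / of_real h :: 'b::real_normed_field)"
proof -
  obtain C where C0: "C \<ge> 0" and C: "\<forall>\<^sub>F h in at_right 0. 0 < h \<and> (\<forall>i. norm (f h i) \<le> C * h^Suc k)"
    by (rule unif_bigoE[OF assms])
  have "\<forall>\<^sub>F h in at_right 0. \<forall>i. norm (f h i / of_real h) \<le> C * h^k"
    using C by eventually_elim (auto simp: norm_divide field_simps)
  then show ?thesis
    unfolding unif_bigo_def by blast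
qed

lemma unif_bigo_vec3:
  fixes f :: "real \<Rightarrow> 'i \<Rightarrow> 'b::real_normed_vector^3"
  assumes "\<And>j. unif_bigo k (\<lambda>h i. f h i $ j)"
  shows "unif_bigo k f"
proof -
  have "unif_bigo k (\<lambda>h i. norm (f h i $ j))" for j
    using assms by (simp add: unif_bigo_def)
  then have "unif_bigo k (\<lambda>h i. norm (f h i $ 1) + norm (f h i $ 2) + norm (f h i $ 3))"
    by (intro unif_bigo_add)
  then obtain C where "C \<ge> 0" and C: "\<forall>\<^sub>F h in at_right 0. 0 < h \<and>
      (\<forall>i. norm (norm (f h i $ 1) + norm (f h i $ 2) + norm (f h i $ 3)) \<le> C * h^k)"
    by (rule unif_bigoE)
  have "norm v \<le> norm (norm (v $ 1) + norm (v $ 2) + norm (v $ 3))" for v :: "'b^3"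
    using L2_set_le_sum[of UNIV "\<lambda>j. norm (v $ j)"] by (simp add: norm_vec_def sum_3)
  then have "\<forall>\<^sub>F h in at_right 0. \<forall>i. norm (f h i) \<le> C * h^k"
    using C by (auto elim!: eventually_mono intro: order_trans)
  then show ?thesis
    unfolding unif_bigo_def by blast
qed

section \<open>Local residuals of the exact solution\<close>
locale oscillator =
  fixes lam :: real and u u' :: "real \<Rightarrow> real"
  assumes lam_pos: "lam > 0"
    and u_deriv: "(u has_real_derivative u' t) (at t)"
    and u'_deriv: "(u' has_real_derivative - lam * u t) (at t)"
begin

text \<open>By conservation of the energy \<open>lam * u^2 + u'^2\<close>.\<close>
lemma u_bounded: "\<exists>C. \<forall>t. \<bar>u t\<bar> \<le> C \<and> \<bar>u' t\<bar> \<le> C"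
proof -
  define E where "E t = lam * (u t)^2 + (u' t)^2" for t
  have "(E has_real_derivative 0) (at t)" for t
    unfolding E_def by (auto intro!: derivative_eq_intros u_deriv u'_deriv)
  then have E: "E t = E 0" for t
    by (rule DERIV_isconst_all[rule_format])
  have "\<bar>u t\<bar> \<le> sqrt (E 0 / lam)" "\<bar>u' t\<bar> \<le> sqrt (E 0)" for t
  proof -
    have "(u t)^2 \<le> E t / lam" "(u' t)^2 \<le> E t"
      using lam_pos by (simp_all add: E_def field_simps)
    then show "\<bar>u t\<bar> \<le> sqrt (E 0 / lam)" "\<bar>u' t\<bar> \<le> sqrt (E 0)"
      by (auto simp: E[of t] intro!: real_le_rsqrt)
  qed
  then show ?thesis
    by (intro exI[of _ "max (sqrt (E 0 / lam)) (sqrt (E 0))"]) (auto simp: le_max_iff_disj)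
qed

text \<open>The remainder of the cubic Taylor polynomial of \<open>u\<close> at \<open>s\<close>, evaluated at \<open>s + c * h\<close>; the second
  and third derivatives are eliminated by the equation.\<close>
definition taylor_rem :: "real \<Rightarrow> real \<Rightarrow> real \<Rightarrow> real" where
  "taylor_rem c h s = u (s + c * h)
     - (u s * (1 - c^2 / 2 * (lam * h^2)) + h * u' s * (c - c^3 / 6 * (lam * h^2)))"

lemma unif_bigo_taylor_rem: "unif_bigo 4 (taylor_rem c)"
proof -
  obtain C where C: "\<And>t. \<bar>u t\<bar> \<le> C"
    using u_bounded by blast
  have "\<bar>taylor_rem c h s\<bar> \<le> (lam^2 * C * c^4 / 24) * h^4" for h s
  proof -
    \<comment> \<open>The equation turns every second derivative into a factor \<open>- lam\<close>.\<close>
    define diff where "diff m \<tau> = (- lam)^(m div 2) * (if even m then u (s + \<tau>) else u' (s + \<tau>))" for m \<tau>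
    have "(diff m has_real_derivative diff (Suc m) \<tau>) (at \<tau>)" for m \<tau>
    proof -
      have "((\<lambda>\<tau>. u (s + \<tau>)) has_real_derivative u' (s + \<tau>)) (at \<tau>)"
        "((\<lambda>\<tau>. u' (s + \<tau>)) has_real_derivative - lam * u (s + \<tau>)) (at \<tau>)"
        using DERIV_shift[THEN iffD1, OF u_deriv[of "\<tau> + s"]]
          DERIV_shift[THEN iffD1, OF u'_deriv[of "\<tau> + s"]]
        by (simp_all add: add.commute)
      then show ?thesis
        unfolding diff_def by (cases "even m") (auto intro!: derivative_eq_intros elim!: evenE oddE)
    qed
    moreover have "diff 0 = (\<lambda>\<tau>. u (s + \<tau>))"
      by (simp add: diff_def fun_eq_iff)
    ultimately obtain t where taylor: "u (s + c * h) = (\<Sum>m<4. diff m 0 / fact m * (c * h)^m) + diff 4 t / fact 4 * (c * h)^4"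
      using Maclaurin_all_le[of diff "\<lambda>\<tau>. u (s + \<tau>)" "c * h" 4] by blast
    have "taylor_rem c h s = lam^2 * u (s + t) / 24 * (c * h)^4"
    proof -
      have diffs: "diff 0 \<tau> = u (s + \<tau>)" "diff 1 \<tau> = u' (s + \<tau>)" "diff 2 \<tau> = - lam * u (s + \<tau>)"
        "diff 3 \<tau> = - lam * u' (s + \<tau>)" "diff 4 \<tau> = lam^2 * u (s + \<tau>)" for \<tau>
        by (simp_all add: diff_def)
      have sum4: "(\<Sum>m<4. f m) = f 0 + f 1 + f 2 + f 3" for f :: "nat \<Rightarrow> real"
        by (simp add: eval_nat_numeral)
      have facts: "fact 2 = (2::real)" "fact 3 = (6::real)" "fact 4 = (24::real)"
        by (simp_all add: fact_numeral)
      show ?thesis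
        using taylor unfolding taylor_rem_def sum4 diffs facts
        by (simp add: power_mult_distrib power2_eq_square power3_eq_cube field_simps)
    qed
    moreover have "\<bar>lam^2 * u (s + t) / 24 * (c * h)^4\<bar> \<le> lam^2 * C / 24 * (c * h)^4"
      using C[of "s + t"] by (auto simp: abs_mult intro!: mult_mono divide_right_mono)
    ultimately show ?thesis
      by (simp add: power_mult_distrib mult_ac)
  qed
  then show ?thesis
    unfolding unif_bigo_def by (intro exI[of _ "lam^2 * C * c^4 / 24"]) auto
qed

lemma unif_bigo_u: "unif_bigo 0 (\<lambda>h. u)" and unif_bigo_u': "unif_bigo 0 (\<lambda>h. u')"
proof -
  obtain C where "\<And>t. \<bar>u t\<bar> \<le> C" "\<And>t. \<bar>u' t\<bar> \<le> C"
    using u_bounded by blast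
  then show "unif_bigo 0 (\<lambda>h. u)" "unif_bigo 0 (\<lambda>h. u')"
    by - (rule unif_bigo_bounded[of _ C], simp)+
qed

lemma unif_bigo_monomial:
  assumes "isCont c 0" "unif_bigo 0 (\<lambda>h. f)"
  shows "unif_bigo k (\<lambda>h s. h^k * (c h * f s :: real))"
  using unif_bigo_mult[OF unif_bigo_step_power[of k] unif_bigo_coeff[OF assms]] by simp

text \<open>Row \<open>i\<close> of the local error at the time \<open>s = t_n\<close>, times \<open>eig_den\<close>; the number \<open>c\<close> is the position
  of node \<open>i\<close> in the new slab.\<close>
definition residual :: "real \<Rightarrow> 3 \<Rightarrow> real \<Rightarrow> real \<Rightarrow> real \<Rightarrow> real" where
  "residual a i c h s = eig_den a (lam * h^2) * u (s + c * h)
     - (G_num a (lam * h^2) $ i $ 1 * u (s + (-1) * h) + G_num a (lam * h^2) $ i $ 2 * u (s + (-1/2) * h)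
        + G_num a (lam * h^2) $ i $ 3 * u s)"

text \<open>Insertion of the Taylor polynomials. The multiples of \<open>u s\<close> cancel up to order \<open>h^2\<close> included and
  those of \<open>u' s\<close> up to order \<open>h\<close> included; parity rules out \<open>h^3\<close> for the former and \<open>h^2\<close> for the
  latter.\<close>
lemma residual_2_eq:
  "residual a 2 (1/2) h s =
     h^3 * (lam * (9 + 72*a + (27/2*a - 1/4) * (lam * h^2) + (1/24 - a/8) * (lam * h^2)^2) * u' s)
     + h^4 * (lam^2 * ((1/4 - 9/4*a) * (lam * h^2) - 3/2) * u s)
     + (eig_den a (lam * h^2) * taylor_rem (1/2) h s - G_num a (lam * h^2) $ 2 $ 1 * taylor_rem (-1) h s
        - G_num a (lam * h^2) $ 2 $ 2 * taylor_rem (-1/2) h s)"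
  unfolding residual_def taylor_rem_def G_num_def vector_3 eig_den_def by (simp add: field_simps) algebra

lemma residual_3_eq:
  "residual a 3 1 h s =
     h^3 * (lam * (12 + 144*a + (6*a - 1) * (lam * h^2) + (1/3 - 7/2*a) * (lam * h^2)^2) * u' s)
     + h^4 * (lam^2 * ((1 - 9*a) * (lam * h^2) + 6) * u s)
     + (eig_den a (lam * h^2) * taylor_rem 1 h s - G_num a (lam * h^2) $ 3 $ 1 * taylor_rem (-1) h s
        - G_num a (lam * h^2) $ 3 $ 2 * taylor_rem (-1/2) h s)"
  unfolding residual_def taylor_rem_def G_num_def vector_3 eig_den_def by (simp add: field_simps) algebra

text \<open>The combination of the two residuals that the eigenvector matrix amplifies, to leading order. For
  general \<open>a\<close> it contains \<open>36 * a * lam * h^3 * u' s\<close>, and this is the only term of order \<open>h^3\<close>.\<close>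
lemma residual_combination_eq:
  "3/4 * residual 0 3 1 h s - residual 0 2 (1/2) h s =
     h^4 * (h * lam^2 * (5/24 * (lam * h^2) - 1/2) * u' s) + h^4 * (lam^2 * (6 + 1/2 * (lam * h^2)) * u s)
     + (eig_den 0 (lam * h^2) * (3/4 * taylor_rem 1 h s - taylor_rem (1/2) h s)
        - (3/4 * G_num 0 (lam * h^2) $ 3 $ 1 - G_num 0 (lam * h^2) $ 2 $ 1) * taylor_rem (-1) h s
        - (3/4 * G_num 0 (lam * h^2) $ 3 $ 2 - G_num 0 (lam * h^2) $ 2 $ 2) * taylor_rem (-1/2) h s)"
  unfolding residual_2_eq residual_3_eq by (simp add: field_simps) algebra

lemma isCont_eig_den [continuous_intros]: "isCont (\<lambda>h. eig_den a (lam * h^2)) 0"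
  unfolding eig_den_def by (intro continuous_intros)

lemma isCont_G_num [continuous_intros]: "isCont (\<lambda>h. G_num a (lam * h^2) $ i $ j) 0"
proof -
  have "\<forall>i j. isCont (\<lambda>h. G_num a (lam * h^2) $ i $ j) 0"
    unfolding forall_3 G_num_def vector_3 by (intro conjI continuous_intros)
  then show ?thesis
    by blast
qed

lemma unif_bigo_taylor_rem_combination:
  assumes "k \<le> 4" "isCont f1 0" "isCont f2 0" "isCont f3 0"
  shows "unif_bigo k (\<lambda>h s. f1 h * taylor_rem c1 h s - f2 h * taylor_rem c2 h s - f3 h * taylor_rem c3 h s)"
  by (intro unif_bigo_mono[OF _ assms(1)] unif_bigo_diff unif_bigo_coeff[OF _ unif_bigo_taylor_rem] assms)

lemma unif_bigo_residual:
  shows "unif_bigo 3 (residual a 2 (1/2))" "unif_bigo 3 (residual a 3 1)"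
proof -
  have u: "unif_bigo 3 (\<lambda>h s. h^4 * (c h * u s))" if "isCont c 0" for c
    by (rule unif_bigo_mono[OF unif_bigo_monomial[OF that unif_bigo_u]]) simp
  have u': "unif_bigo 3 (\<lambda>h s. h^3 * (c h * u' s))" if "isCont c 0" for c
    by (rule unif_bigo_monomial[OF that unif_bigo_u'])
  show "unif_bigo 3 (residual a 2 (1/2))" "unif_bigo 3 (residual a 3 1)"
    unfolding residual_2_eq[abs_def] residual_3_eq[abs_def]
    by (rule unif_bigo_add unif_bigo_taylor_rem_combination u u' | (intro continuous_intros; fail) | simp)+
qed

lemma unif_bigo_residual_combination:
  "unif_bigo 4 (\<lambda>h s. 3/4 * residual 0 3 1 h s - residual 0 2 (1/2) h s)"
proof -
  have taylor_rem: "unif_bigo 4 (\<lambda>h s. f h * (3/4 * taylor_rem 1 h s - taylor_rem (1/2) h s) - f2 h * taylor_rem c2 h s - f3 h * taylor_rem c3 h s)"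
    if "isCont f 0" "isCont f2 0" "isCont f3 0" for f f2 f3 c2 c3
    by (intro unif_bigo_diff unif_bigo_coeff[OF _ unif_bigo_taylor_rem] that
        unif_bigo_coeff[OF that(1) unif_bigo_diff[OF unif_bigo_coeff[OF continuous_const unif_bigo_taylor_rem] unif_bigo_taylor_rem]])
  show ?thesis
    unfolding residual_combination_eq
    by (rule unif_bigo_add taylor_rem unif_bigo_monomial[OF _ unif_bigo_u] unif_bigo_monomial[OF _ unif_bigo_u']
        | (intro continuous_intros; fail))+
qed

end

section \<open>Norm estimates and a discrete Gronwall inequality\<close>

lemma norm_matrix_vector_mult:
  fixes M :: "complex^3^3"
  shows "norm (M *v y) \<le> norm M * norm y"
proof -
  have "norm ((M *v y) $ i) \<le> norm (M $ i) * norm y" for i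
  proof -
    have "norm ((M *v y) $ i) \<le> (\<Sum>j\<in>UNIV. norm (M $ i $ j) * norm (y $ j))"
      unfolding matrix_vector_mult_def by (simp add: sum_norm_le norm_mult)
    also have "\<dots> \<le> norm (M $ i) * norm y"
      unfolding norm_vec_def using L2_set_mult_ineq[of "\<lambda>j. norm (M $ i $ j)" "\<lambda>j. norm (y $ j)" UNIV]
      by simp
    finally show ?thesis .
  qed
  then have "norm (M *v y) \<le> L2_set (\<lambda>i. norm (M $ i) * norm y) UNIV"
    unfolding norm_vec_def[of "M *v y"] by (intro L2_set_mono) auto
  also have "\<dots> = norm M * norm y"
    by (simp add: norm_vec_def[of M] L2_set_left_distrib)
  finally show ?thesis .
qed

lemma discrete_gronwall:
  fixes \<epsilon> :: "nat \<Rightarrow> 'b::real_normed_vector"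
  assumes "\<epsilon> 0 = 0" "\<And>n. n < N \<Longrightarrow> norm (\<epsilon> (n + 1)) \<le> b + q * norm (\<epsilon> n)" "q \<ge> 1" "b \<ge> 0" "n \<le> N"
  shows "norm (\<epsilon> n) \<le> real n * b * q^n"
  using assms(5)
proof (induction n)
  case 0
  then show ?case
    using assms(1) by simp
next
  case (Suc n)
  have "norm (\<epsilon> (Suc n)) \<le> b + q * (real n * b * q^n)"
    using assms(2)[of n] Suc assms(3) by (smt (verit) Suc_eq_plus1 Suc_le_lessD less_imp_le mult_left_mono)
  also have "\<dots> \<le> b * q^Suc n + q * (real n * b * q^n)"
    using assms(3,4) one_le_power[OF assms(3), of "Suc n"] mult_left_mono[of 1 "q^Suc n" b] by simp
  also have "\<dots> = real (Suc n) * b * q^Suc n"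
    by (simp add: algebra_simps)
  finally show ?case .
qed

lemma isCont_0_eventually_ne:
  fixes f :: "real \<Rightarrow> real"
  assumes "isCont f 0" "f 0 \<noteq> 0"
  shows "\<forall>\<^sub>F h in at_right 0. f h \<noteq> 0"
proof -
  have "(f \<longlongrightarrow> f 0) (at_right 0)"
    using assms(1) unfolding isCont_def by (rule tendsto_within_subset) simp
  then show ?thesis
    using assms(2) by (rule tendsto_imp_eventually_ne)
qed

section \<open>Local error in eigenvector coordinates\<close>

context oscillator
begin

lemma isCont_inverse_eig_den: "isCont (\<lambda>h. 1 / eig_den a (lam * h^2)) 0"
  by (intro continuous_intros) (simp add: eig_den_def)

lemma isCont_hat_slope [continuous_intros]: "isCont (\<lambda>h. hat_slope (lam * h^2)) 0"
  unfolding hat_slope_def by (intro continuous_intros) simp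

lemma isCont_eig_mid [continuous_intros]: "isCont (\<lambda>h. eig_mid a (lam * h^2)) 0"
  unfolding eig_mid_def eig_mid_num_def by (intro continuous_intros) (simp add: eig_den_def)

lemma isCont_hat_mid [continuous_intros]: "isCont (\<lambda>h. hat_mid a (lam * h^2)) 0"
  unfolding hat_mid_def hat_mid_num_def by (intro continuous_intros) (simp add: eig_den_def)

lemma isCont_W_det_factor [continuous_intros]: "isCont (\<lambda>h. W_det_factor a (lam * h^2)) 0"
  unfolding W_det_factor_def by (intro continuous_intros)

lemma W_det_factor_0: "W_det_factor a 0 = - 1 / 4"
  by (simp add: W_det_factor_def hat_mid_def hat_mid_num_def hat_slope_def eig_mid_def eig_mid_num_def eig_den_def)

lemma norm_R_root:
  "norm (R_root h lam a) = sqrt \<bar>(144 * a^2 - 24 * a + 1) * h^6 * lam^4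
      + (1728 * a^2 + 720 * a - 144) * h^4 * lam^3 + (5184 * a^2 + 3456) * h^2 * lam^2 - 20736 * lam\<bar>"
proof -
  have norm_csqrt: "norm (csqrt z) = sqrt (norm z)" for z
    by (metis norm_ge_zero norm_power power2_csqrt real_sqrt_unique)
  show ?thesis
    unfolding R_root_def norm_csqrt norm_of_real by simp
qed

lemma isCont_norm_R_root [continuous_intros]: "isCont (\<lambda>h. norm (R_root h lam a)) 0"
  unfolding norm_R_root by (intro continuous_intros)

lemma R_root_0: "R_root 0 lam a \<noteq> 0"
  using lam_pos by (simp add: R_root_def)

lemma eventually_regular:
  "\<forall>\<^sub>F h in at_right 0. 0 < h \<and> lam * h^2 < 12 \<and> eig_den a (lam * h^2) \<noteq> 0
     \<and> W_det_factor a (lam * h^2) \<noteq> 0 \<and> R_root h lam a \<noteq> 0"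
proof -
  have "((\<lambda>h. lam * h^2) \<longlongrightarrow> lam * 0^2) (at_right 0)"
    by (intro tendsto_intros)
  then have "\<forall>\<^sub>F h in at_right 0. lam * h^2 < 12"
    by (rule order_tendstoD) simp
  moreover have "\<forall>\<^sub>F h in at_right 0. eig_den a (lam * h^2) \<noteq> 0"
    by (rule isCont_0_eventually_ne[OF isCont_eig_den]) (simp add: eig_den_def)
  moreover have "\<forall>\<^sub>F h in at_right 0. W_det_factor a (lam * h^2) \<noteq> 0"
    by (rule isCont_0_eventually_ne[OF isCont_W_det_factor]) (simp add: W_det_factor_0)
  moreover have "\<forall>\<^sub>F h in at_right 0. norm (R_root h lam a) \<noteq> 0"
    by (rule isCont_0_eventually_ne[OF isCont_norm_R_root]) (simp add: R_root_0)
  ultimately show ?thesis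
    using eventually_pos by eventually_elim auto
qed

lemma eventually_diagonalization:
  "\<forall>\<^sub>F h in at_right 0. invertible (A_plus h lam (a * h^2) 0) \<and> invertible (W_mat h lam a) \<and>
     cmat (G_mat h lam a) = W_mat h lam a ** D_mat h lam a ** matrix_inv (W_mat h lam a)"
  using eventually_regular[of a]
proof eventually_elim
  case (elim h)
  then have "invertible (W_mat h lam a)"
    by (simp add: invertible_det_nz det_W_mat eig_half_gap_def)
  moreover from this have "W_mat h lam a ** matrix_inv (W_mat h lam a) = mat 1"
    using matrix_inv_left matrix_left_right_inverse by blast
  then have "cmat (G_mat h lam a) = W_mat h lam a ** D_mat h lam a ** matrix_inv (W_mat h lam a)"
    using G_mat_W_mat[of h lam a] elim lam_pos
    by (metis matrix_mul_assoc matrix_mul_rid)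
  ultimately show ?case
    using elim lam_pos invertible_A_plus by blast
qed

text \<open>The first row vanishes exactly: the last node of a slab is the first node of the next one, and the
  scheme passes this value on.\<close>
lemma theta_eq:
  assumes "h > 0" "eig_den a (lam * h^2) \<noteq> 0"
  shows "theta h lam a u n = vector [0, 1 / eig_den a (lam * h^2) * residual a 2 (1/2) h (real n * h),
     1 / eig_den a (lam * h^2) * residual a 3 1 h (real n * h)]"
proof -
  have old: "u_ex h u n = vector [u (n * h + (-1) * h), u (n * h + (-1/2) * h), u (n * h)]"
    and new: "u_ex h u (n + 1) = vector [u (n * h), u (n * h + 1/2 * h), u (n * h + 1 * h)]"
    by (simp_all add: vec_eq_iff forall_3 u_ex_def node_def tm_def algebra_simps add_divide_distrib diff_divide_distrib)
  have "G_num a (lam * h^2) $ 1 = vector [0, 0, eig_den a (lam * h^2)]"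
    by (simp add: G_num_def)
  then show ?thesis
    unfolding theta_def old new G_mat_eq[OF assms(1) lam_pos assms(2)]
    using assms(2)
    by (simp add: vec_eq_iff forall_3 matrix_vector_mult_def sum_3 residual_def)
      (simp add: field_simps)
qed

lemma unif_bigo_theta: "unif_bigo 3 (\<lambda>h n. theta h lam a u n)"
proof -
  let ?v = "\<lambda>h n. vector [0, 1 / eig_den a (lam * h^2) * residual a 2 (1/2) h (real n * h),
     1 / eig_den a (lam * h^2) * residual a 3 1 h (real n * h)] :: real^3"
  have "\<forall>j. unif_bigo 3 (\<lambda>h n. ?v h n $ j)"
    unfolding forall_3 vector_3
    by (intro conjI unif_bigo_coeff[OF isCont_inverse_eig_den] unif_bigo_residual[THEN unif_bigo_reindex])
      (auto simp: unif_bigo_def intro!: exI[of _ 0])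
  then have "unif_bigo 3 ?v"
    by (intro unif_bigo_vec3) blast
  then show ?thesis
  proof (rule unif_bigo_cong)
    show "\<forall>\<^sub>F h in at_right 0. \<forall>n. theta h lam a u n = ?v h n"
      using eventually_regular[of a] by eventually_elim (use theta_eq in blast)
  qed
qed

text \<open>The combination of the local errors that is divided by the gap between the eigenvalues. To leading
  order it is the second component minus three quarters of the third.\<close>
definition gap_part :: "real \<Rightarrow> real \<Rightarrow> nat \<Rightarrow> real" where
  "gap_part a h n = eig_mid a (lam * h^2) * theta h lam a u n $ 2
     + (1 / 4 - hat_mid a (lam * h^2)) * theta h lam a u n $ 3"

lemma unif_bigo_theta_nth: "unif_bigo 3 (\<lambda>h n. theta h lam a u n $ i)"
proof -
  obtain C where "C \<ge> 0" and C: "\<forall>\<^sub>F h in at_right 0. 0 < h \<and> (\<forall>n. norm (theta h lam a u n) \<le> C * h^3)"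
    using unif_bigo_theta by (rule unif_bigoE)
  then show ?thesis
    unfolding unif_bigo_def
    by (intro exI[of _ C]) (auto elim!: eventually_mono intro: order_trans[OF component_le_norm_cart])
qed

lemma unif_bigo_gap_part: "unif_bigo 3 (gap_part a)"
  unfolding gap_part_def[abs_def]
  by (intro unif_bigo_add unif_bigo_coeff[OF _ unif_bigo_theta_nth] continuous_intros)

lemma unif_bigo_eig_mid: "unif_bigo 2 (\<lambda>h i. eig_mid a (lam * h^2) - 1)"
proof -
  have "unif_bigo (2 + 0) (\<lambda>h i. h^2 * (lam * ((1 - 12 * a) * (lam * h^2) + 72 - 72 * a) / eig_den a (lam * h^2)))"
    by (intro unif_bigo_mult unif_bigo_step_power unif_bigo_cont continuous_intros) (simp add: eig_den_def)
  moreover have "\<forall>\<^sub>F h in at_right 0. \<forall>i. eig_mid a (lam * h^2) - 1 =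
      h^2 * (lam * ((1 - 12 * a) * (lam * h^2) + 72 - 72 * a) / eig_den a (lam * h^2))"
    using eventually_regular[of a]
  proof eventually_elim
    case (elim h)
    have "eig_mid_num a (lam * h^2) - eig_den a (lam * h^2) = h^2 * (lam * ((1 - 12 * a) * (lam * h^2) + 72 - 72 * a))"
      unfolding eig_mid_num_def eig_den_def by algebra
    then show ?case
      using elim by (simp add: eig_mid_def divide_simps)
  qed
  ultimately show ?thesis
    using unif_bigo_cong by fastforce
qed

lemma unif_bigo_hat_mid: "unif_bigo 2 (\<lambda>h i. 1 - hat_mid a (lam * h^2))"
proof -
  let ?q = "\<lambda>h. lam * ((42 * a - 5) * (lam * h^2)^2 + 48 * (lam * h^2) + 432 - 864 * a)"
  let ?d = "\<lambda>h. (2 * (lam * h^2) - 24) * eig_den a (lam * h^2)"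
  have "unif_bigo (2 + 0) (\<lambda>h i. h^2 * (?q h / ?d h))"
    by (intro unif_bigo_mult unif_bigo_step_power unif_bigo_cont continuous_intros) (simp add: eig_den_def)
  moreover have "\<forall>\<^sub>F h in at_right 0. \<forall>i. 1 - hat_mid a (lam * h^2) = h^2 * (?q h / ?d h)"
    using eventually_regular[of a]
  proof eventually_elim
    case (elim h)
    have "?d h - hat_mid_num a (lam * h^2) = h^2 * ?q h"
      unfolding hat_mid_num_def eig_den_def by algebra
    moreover have "?d h \<noteq> 0"
      using elim by simp
    ultimately show ?case
      unfolding hat_mid_def times_divide_eq_right by (metis diff_divide_distrib divide_self)
  qed
  ultimately show ?thesis
    using unif_bigo_cong by fastforce
qed

text \<open>The leading part of \<open>gap_part\<close> is the combination whose \<open>h^3\<close> term vanishes for \<open>a = 0\<close>; the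
  corrections carry a factor \<open>h^2\<close> from \<open>eig_mid\<close> and \<open>hat_mid\<close>, both of which are \<open>1 + O(h^2)\<close>.\<close>
lemma unif_bigo_gap_part_0: "unif_bigo 4 (gap_part 0)"
proof -
  let ?t = "\<lambda>h n. theta h lam 0 u n"
  let ?c = "\<lambda>h n. 1 / eig_den 0 (lam * h^2) *
     (3/4 * residual 0 3 1 h (real n * h) - residual 0 2 (1/2) h (real n * h))"
  have "unif_bigo 4 ?c"
    by (intro unif_bigo_coeff[OF isCont_inverse_eig_den] unif_bigo_residual_combination[THEN unif_bigo_reindex])
  moreover have "unif_bigo 4 (\<lambda>h n. (eig_mid 0 (lam * h^2) - 1) * ?t h n $ 2)"
    "unif_bigo 4 (\<lambda>h n. (1 - hat_mid 0 (lam * h^2)) * ?t h n $ 3)"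
    by (rule unif_bigo_mono[OF unif_bigo_mult[OF unif_bigo_eig_mid unif_bigo_theta_nth]], simp)
      (rule unif_bigo_mono[OF unif_bigo_mult[OF unif_bigo_hat_mid unif_bigo_theta_nth]], simp)
  ultimately have "unif_bigo 4 (\<lambda>h n. (eig_mid 0 (lam * h^2) - 1) * ?t h n $ 2
      + (1 - hat_mid 0 (lam * h^2)) * ?t h n $ 3 - ?c h n)"
    by (intro unif_bigo_add unif_bigo_diff)
  then show ?thesis
  proof (rule unif_bigo_cong)
    show "\<forall>\<^sub>F h in at_right 0. \<forall>n. gap_part 0 h n = (eig_mid 0 (lam * h^2) - 1) * ?t h n $ 2
      + (1 - hat_mid 0 (lam * h^2)) * ?t h n $ 3 - ?c h n"
      using eventually_regular[of 0]
      by eventually_elim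
        (simp add: theta_eq gap_part_def, simp add: algebra_simps add_divide_distrib diff_divide_distrib)
  qed
qed

text \<open>One power of \<open>h\<close> is lost on \<open>gap_part\<close>, and none on the kernel coefficient.\<close>
lemma unif_bigo_W_inverse_theta:
  assumes "unif_bigo (Suc k) (gap_part a)" "k \<le> 3"
  shows "unif_bigo k (\<lambda>h n. matrix_inv (W_mat h lam a) *v cvec (theta h lam a u n))"
proof -
  define c where "c h n = complex_of_real (1 / W_det_factor a (lam * h^2) *
     (theta h lam a u n $ 2 + hat_slope (lam * h^2) * theta h lam a u n $ 3))" for h n
  define m where "m h n = complex_of_real (1 / W_det_factor a (lam * h^2) * gap_part a h n) *
     (complex_of_real (eig_den a (lam * h^2)) / R_root h lam a) / complex_of_real h" for h n
  have inv_W_det_factor: "isCont (\<lambda>h. 1 / W_det_factor a (lam * h^2)) 0"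
    by (intro continuous_intros) (simp add: W_det_factor_0)
  have "unif_bigo 3 c"
    unfolding c_def[abs_def]
    by (intro unif_bigo_of_real unif_bigo_coeff[OF inv_W_det_factor] unif_bigo_add unif_bigo_theta_nth
        unif_bigo_coeff[OF isCont_hat_slope])
  then have c: "unif_bigo k c"
    using assms(2) by (rule unif_bigo_mono)
  have "isCont (\<lambda>h. norm (complex_of_real (eig_den a (lam * h^2)) / R_root h lam a)) 0"
    unfolding norm_divide norm_of_real by (intro continuous_intros) (simp add: R_root_0)
  then have "unif_bigo (Suc k + 0) (\<lambda>h n. complex_of_real (1 / W_det_factor a (lam * h^2) * gap_part a h n) *
     (complex_of_real (eig_den a (lam * h^2)) / R_root h lam a))"
    by (intro unif_bigo_mult unif_bigo_cont_norm unif_bigo_of_real unif_bigo_coeff[OF inv_W_det_factor] assms(1))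
  then have m: "unif_bigo k m"
    unfolding m_def[abs_def] by (intro unif_bigo_divide_step) simp
  have half: "isCont (\<lambda>h. 1 / 2 :: complex) 0"
    by simp
  let ?v = "\<lambda>h n. vector [c h n, 1/2 * (m h n - c h n), 1/2 * (- m h n - c h n)] :: complex^3"
  have "\<forall>j. unif_bigo k (\<lambda>h n. ?v h n $ j)"
    unfolding forall_3 vector_3
    by (intro conjI c unif_bigo_coeff[OF half] unif_bigo_diff unif_bigo_minus m)
  then have "unif_bigo k ?v"
    by (intro unif_bigo_vec3) blast
  then show ?thesis
  proof (rule unif_bigo_cong)
    show "\<forall>\<^sub>F h in at_right 0. \<forall>n. matrix_inv (W_mat h lam a) *v cvec (theta h lam a u n) = ?v h n"
      using eventually_regular[of a]
    proof eventually_elim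
      case (elim h)
      show ?case
      proof
        fix n
        have cvec: "cvec (theta h lam a u n) =
            vector [0, complex_of_real (theta h lam a u n $ 2), complex_of_real (theta h lam a u n $ 3)]"
          using elim by (simp add: cvec_def vec_eq_iff forall_3 theta_eq)
        have nz: "eig_half_gap h lam a \<noteq> 0" "W_det_factor a (lam * h^2) \<noteq> 0"
          using elim by (simp_all add: eig_half_gap_def)
        show "matrix_inv (W_mat h lam a) *v cvec (theta h lam a u n) = ?v h n"
          unfolding cvec matrix_inv_W_mat_apply[OF nz]
          by (simp add: c_def m_def gap_part_def eig_half_gap_def vec_eq_iff forall_3)
      qed
    qed
  qed
qed

section \<open>Accumulation of the local errors\<close>

lemma unif_bigo_eig_half_gap: "unif_bigo 1 (\<lambda>h i. eig_half_gap h lam a)"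
proof -
  have "isCont (\<lambda>h. norm (R_root h lam a / complex_of_real (eig_den a (lam * h^2)))) 0"
    unfolding norm_divide norm_of_real by (intro continuous_intros) (simp add: eig_den_def)
  then have "unif_bigo (1 + 0) (\<lambda>h i. complex_of_real (h^1) * (R_root h lam a / complex_of_real (eig_den a (lam * h^2))))"
    by (intro unif_bigo_mult unif_bigo_cont_norm unif_bigo_of_real unif_bigo_step_power)
  then show ?thesis
    by (simp add: eig_half_gap_def[abs_def])
qed

lemma unif_bigo_eigval: "unif_bigo 1 (\<lambda>h i. eigval h lam a \<sigma> - 1)"
proof -
  have "unif_bigo 1 (\<lambda>h i. complex_of_real (eig_mid a (lam * h^2) - 1) + \<sigma> * eig_half_gap h lam a)"
    by (intro unif_bigo_add unif_bigo_of_real unif_bigo_mono[OF unif_bigo_eig_mid]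
        unif_bigo_coeff[OF continuous_const] unif_bigo_eig_half_gap) simp
  then show ?thesis
    by (simp add: eigval_eq algebra_simps)
qed

lemma unif_bigo_W_mat: "unif_bigo 0 (\<lambda>h i. W_mat h lam a)"
proof -
  have eig_half_gap: "unif_bigo 0 (\<lambda>h i. eig_half_gap h lam a)"
    using unif_bigo_eig_half_gap by (rule unif_bigo_mono) simp
  have eigval: "unif_bigo 0 (\<lambda>h i. eigval h lam a \<sigma>)" for \<sigma>
    unfolding eigval_eq
    by (intro unif_bigo_add unif_bigo_of_real unif_bigo_cont[OF isCont_eig_mid]
        unif_bigo_coeff[OF continuous_const] eig_half_gap)
  have hat_slope: "isCont (\<lambda>h. \<sigma> * complex_of_real (hat_slope (lam * h^2))) 0" for \<sigma>
    by (intro continuous_intros)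
  have eighat: "unif_bigo 0 (\<lambda>h i. eighat h lam a \<sigma>)" for \<sigma>
    unfolding eighat_eq
    by (intro unif_bigo_diff unif_bigo_of_real unif_bigo_cont[OF isCont_hat_mid]
        unif_bigo_coeff[OF hat_slope] eig_half_gap)
  have "\<forall>i j. unif_bigo 0 (\<lambda>h (_::'i). W_mat h lam a $ i $ j)"
    unfolding forall_3 W_mat_def vector_3
    by (intro conjI eigval eighat unif_bigo_cont continuous_const)
  then show ?thesis
    by (intro unif_bigo_vec3) blast
qed

lemma norm_D_mat_vector_mult:
  assumes "norm (eigval h lam a 1) \<le> q" "norm (eigval h lam a (- 1)) \<le> q"
  shows "norm (D_mat h lam a *v y) \<le> q * norm y"
proof -
  have q: "q \<ge> 0"
    using assms(1) norm_ge_zero order_trans by blast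
  have "\<forall>i. norm ((D_mat h lam a *v y) $ i) \<le> norm ((q *\<^sub>R y) $ i)"
    unfolding forall_3 using assms q
    by (simp add: D_mat_def matrix_vector_mult_def sum_3 norm_mult mult_right_mono)
  then have "norm (D_mat h lam a *v y) \<le> norm (q *\<^sub>R y)"
    by (intro norm_le_componentwise_cart) blast
  then show ?thesis
    using q by simp
qed

text \<open>In eigenvector coordinates the error recursion is diagonal with factors of modulus at most
  \<open>1 + K * h\<close>. Over \<open>N \<le> T / h\<close> steps these grow by at most \<open>exp (K * T)\<close>, and the sum of the local
  errors loses one power of \<open>h\<close>. The way back is free, since the eigenvector matrix itself stays
  bounded.\<close>
lemma error_bound:
  assumes "unif_bigo (Suc k) (\<lambda>h n. matrix_inv (W_mat h lam a) *v cvec (theta h lam a u n))" "T \<ge> 0"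
  shows "\<exists>C. \<forall>\<^sub>F h in at_right 0. \<forall>N e. real N * h \<le> T \<longrightarrow> e 0 = 0 \<longrightarrow>
     (\<forall>n<N. e (n + 1) = theta h lam a u n + G_mat h lam a *v e n) \<longrightarrow> (\<forall>n\<le>N. norm (e n) \<le> C * h^k)"
proof -
  obtain B where B0: "B \<ge> 0" and B: "\<forall>\<^sub>F h in at_right 0. 0 < h \<and>
      (\<forall>n. norm (matrix_inv (W_mat h lam a) *v cvec (theta h lam a u n)) \<le> B * h^Suc k)"
    using assms(1) by (rule unif_bigoE)
  obtain K1 where K1: "K1 \<ge> 0" "\<forall>\<^sub>F h in at_right 0. 0 < h \<and> (\<forall>i::unit. norm (eigval h lam a 1 - 1) \<le> K1 * h^1)"
    using unif_bigo_eigval by (rule unif_bigoE)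
  obtain K2 where K2: "K2 \<ge> 0" "\<forall>\<^sub>F h in at_right 0. 0 < h \<and> (\<forall>i::unit. norm (eigval h lam a (-1) - 1) \<le> K2 * h^1)"
    using unif_bigo_eigval by (rule unif_bigoE)
  obtain V where V0: "V \<ge> 0" and V: "\<forall>\<^sub>F h in at_right 0. 0 < h \<and> (\<forall>i::unit. norm (W_mat h lam a) \<le> V * h^0)"
    using unif_bigo_W_mat by (rule unif_bigoE)
  define K where "K = K1 + K2"
  have "\<forall>\<^sub>F h in at_right 0. \<forall>N e. real N * h \<le> T \<longrightarrow> e 0 = 0 \<longrightarrow>
     (\<forall>n<N. e (n + 1) = theta h lam a u n + G_mat h lam a *v e n) \<longrightarrow>
     (\<forall>n\<le>N. norm (e n) \<le> V * T * B * exp (K * T) * h^k)"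
    using B K1(2) K2(2) V eventually_diagonalization[of a]
  proof eventually_elim
    case (elim h)
    let ?W = "W_mat h lam a" and ?D = "D_mat h lam a"
    have h: "h > 0"
      using elim by simp
    define q where "q = 1 + K * h"
    have q: "q \<ge> 1"
      using h K1(1) K2(1) by (simp add: q_def K_def)
    have "norm z \<le> q" if "norm (z - 1) \<le> L * h" "L \<le> K" for z :: complex and L
    proof -
      have "norm z \<le> norm (z - 1) + 1"
        using norm_triangle_ineq[of "z - 1" 1] by simp
      also have "\<dots> \<le> q"
        using that(1) h mult_right_mono[OF that(2), of h] unfolding q_def by linarith
      finally show ?thesis .
    qed
    then have eig: "norm (eigval h lam a 1) \<le> q" "norm (eigval h lam a (- 1)) \<le> q"
      using elim K1(1) K2(1) by (auto simp: K_def)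
    have inv: "matrix_inv ?W ** ?W = mat 1" "?W ** matrix_inv ?W = mat 1"
      using elim matrix_inv_left matrix_left_right_inverse by blast+
    show ?case
    proof (intro allI impI)
      fix N n and e :: "nat \<Rightarrow> real^3"
      assume N: "real N * h \<le> T" and e0: "e 0 = 0" and n: "n \<le> N"
        and step: "\<forall>n<N. e (n + 1) = theta h lam a u n + G_mat h lam a *v e n"
      define \<epsilon> where "\<epsilon> n = matrix_inv ?W *v cvec (e n)" for n
      have \<epsilon>0: "\<epsilon> 0 = 0"
        by (simp add: \<epsilon>_def e0 cvec_def vec_eq_iff matrix_vector_mult_def)
      have \<epsilon>_step: "\<epsilon> (n + 1) = matrix_inv ?W *v cvec (theta h lam a u n) + ?D *v \<epsilon> n" if "n < N" for n
      proof -
        have "cvec (e (n + 1)) = cvec (theta h lam a u n) + cmat (G_mat h lam a) *v cvec (e n)"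
          using step that by (simp add: cvec_matrix_vector[symmetric]) (simp add: cvec_def vec_eq_iff)
        moreover have "matrix_inv ?W ** cmat (G_mat h lam a) = ?D ** matrix_inv ?W"
          using elim inv by (metis matrix_mul_assoc matrix_mul_lid)
        ultimately show ?thesis
          by (simp add: \<epsilon>_def matrix_vector_right_distrib matrix_vector_mul_assoc)
      qed
      have "norm (\<epsilon> (n + 1)) \<le> B * h^Suc k + q * norm (\<epsilon> n)" if "n < N" for n
        unfolding \<epsilon>_step[OF that] using elim
        by (intro norm_triangle_mono norm_D_mat_vector_mult eig) auto
      then have "norm (\<epsilon> n) \<le> real n * (B * h^Suc k) * q^n"
        using \<epsilon>0 q n B0 h by (intro discrete_gronwall) auto
      also have "\<dots> = (real n * h) * B * q^n * h^k"
        by simp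
      also have "\<dots> \<le> T * B * exp (K * T) * h^k"
      proof -
        have nh: "real n * h \<le> T"
          using n N h by (meson mult_right_mono of_nat_mono less_imp_le order_trans)
        have "q^n \<le> exp (K * h)^n"
          using q by (intro power_mono) (auto simp: q_def)
        also have "\<dots> = exp (K * (real n * h))"
          by (simp add: mult_ac flip: exp_of_nat_mult)
        also have "\<dots> \<le> exp (K * T)"
          using nh K1(1) K2(1) by (simp add: K_def mult_left_mono)
        finally show ?thesis
          using nh h B0 q assms(2) by (intro mult_right_mono mult_mono) auto
      qed
      finally have \<epsilon>_bound: "norm (\<epsilon> n) \<le> T * B * exp (K * T) * h^k" .
      have "cvec (e n) = ?W *v \<epsilon> n"
        by (simp add: \<epsilon>_def matrix_vector_mul_assoc inv)
      then have "norm (e n) \<le> norm ?W * norm (\<epsilon> n)"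
        using norm_matrix_vector_mult[of ?W "\<epsilon> n"] by (simp flip: norm_cvec[of "e n"])
      also have "\<dots> \<le> V * (T * B * exp (K * T) * h^k)"
        using \<epsilon>_bound elim V0 by (intro mult_mono) auto
      finally show "norm (e n) \<le> V * T * B * exp (K * T) * h^k"
        by (simp add: mult_ac)
    qed
  qed
  then show ?thesis
    by blast
qed

end

theorem theorem3:
  fixes lam T a u0 u1 :: real
    and u u' :: "real \<Rightarrow> real"
    and U e :: "nat \<Rightarrow> nat \<Rightarrow> real^3"
  assumes lam_pos: "lam > 0" and T_pos: "T > 0"
    and u_deriv: "\<And>t. (u has_real_derivative u' t) (at t)"
    and u_ode: "\<And>t. \<exists>u''. (u' has_real_derivative u'') (at t) \<and> u'' + lam * u t = 0"
    and u_init: "u 0 = u0" "u' 0 = u1"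
    and scheme: "\<And>N n. n < N \<Longrightarrow> U N (n + 1) = G_mat (T / real N) lam a *v U N n"
    and e_eq: "\<And>N n. n \<le> N \<Longrightarrow> e N n = u_ex (T / real N) u n - U N n"
    and e_0: "\<And>N. e N 0 = 0"
  shows
    "(\<forall>\<^sub>F N in sequentially.
        invertible (A_plus (T / real N) lam (a * (T / real N)^2) 0) \<and>
        invertible (W_mat (T / real N) lam a) \<and>
        cmat (G_mat (T / real N) lam a) =
          W_mat (T / real N) lam a ** D_mat (T / real N) lam a
            ** matrix_inv (W_mat (T / real N) lam a)) \<and>
     (\<exists>C. \<forall>\<^sub>F N in sequentially. \<forall>n<N.
        norm (theta (T / real N) lam a u n) \<le> C * (T / real N)^3) \<and>
     (\<exists>C. \<forall>\<^sub>F N in sequentially. \<forall>n<N.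
        norm (matrix_inv (W_mat (T / real N) lam a) *v cvec (theta (T / real N) lam a u n))
          \<le> C * (T / real N)^2) \<and>
     (a = 0 \<longrightarrow> (\<exists>C. \<forall>\<^sub>F N in sequentially. \<forall>n<N.
        norm (matrix_inv (W_mat (T / real N) lam a) *v cvec (theta (T / real N) lam a u n))
          \<le> C * (T / real N)^3)) \<and>
     (a = - 1 / 12 \<or> a = - 1 / 8 \<longrightarrow> (\<exists>C. \<forall>\<^sub>F N in sequentially. \<forall>n\<le>N.
        norm (e N n) \<le> C * (T / real N))) \<and>
     (a = 0 \<longrightarrow> (\<exists>C. \<forall>\<^sub>F N in sequentially. \<forall>n\<le>N.
        norm (e N n) \<le> C * (T / real N)^2))"
proof -
  interpret oscillator lam u u'
  proof
    fix t
    obtain u'' where "(u' has_real_derivative u'') (at t)" "u'' + lam * u t = 0"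
      using u_ode by blast
    moreover from this have "u'' = - lam * u t"
      by simp
    ultimately show "(u' has_real_derivative - lam * u t) (at t)"
      by simp
  qed (use lam_pos u_deriv in auto)
  have lim: "filterlim (\<lambda>N. T / real N) (at_right 0) sequentially"
    unfolding filterlim_at using T_pos
    by (auto intro!: tendsto_divide_0[OF tendsto_const] filterlim_real_sequentially
        filterlim_at_top_imp_at_infinity eventually_mono[OF eventually_gt_at_top[of 0]])
  have transfer: "\<forall>\<^sub>F N in sequentially. P (T / real N)" if "\<forall>\<^sub>F h in at_right 0. P h" for P
    using eventually_compose_filterlim[OF that lim] .
  have bound: "\<exists>C. \<forall>\<^sub>F N in sequentially. \<forall>n<N. norm (f (T / real N) n) \<le> C * (T / real N)^k"
    if f: "unif_bigo k f" for k and f :: "real \<Rightarrow> nat \<Rightarrow> 'b::real_normed_vector"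
  proof -
    obtain C where "\<forall>\<^sub>F h in at_right 0. \<forall>n. norm (f h n) \<le> C * h^k"
      using f unfolding unif_bigo_def by blast
    from transfer[OF this] show ?thesis
      by (auto elim!: eventually_mono)
  qed
  have W2: "unif_bigo 2 (\<lambda>h n. matrix_inv (W_mat h lam a) *v cvec (theta h lam a u n))"
    by (rule unif_bigo_W_inverse_theta) (simp_all add: unif_bigo_gap_part flip: numeral_3_eq_3)
  have W3: "unif_bigo 3 (\<lambda>h n. matrix_inv (W_mat h lam a) *v cvec (theta h lam a u n))" if "a = 0"
    by (rule unif_bigo_W_inverse_theta) (simp_all add: unif_bigo_gap_part_0 that)
  have error: "\<exists>C. \<forall>\<^sub>F N in sequentially. \<forall>n\<le>N. norm (e N n) \<le> C * (T / real N)^k"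
    if W: "unif_bigo (Suc k) (\<lambda>h n. matrix_inv (W_mat h lam a) *v cvec (theta h lam a u n))" for k
  proof -
    have recursion: "e N (n + 1) = theta (T / real N) lam a u n + G_mat (T / real N) lam a *v e N n"
      if "n < N" for N n
      using e_eq[of n N] e_eq[of "n + 1" N] scheme[OF that] that
      by (simp add: theta_def matrix_vector_mult_diff_distrib)
    obtain C where "\<forall>\<^sub>F h in at_right 0. \<forall>N e. real N * h \<le> T \<longrightarrow> e 0 = 0 \<longrightarrow>
       (\<forall>n<N. e (n + 1) = theta h lam a u n + G_mat h lam a *v e n) \<longrightarrow> (\<forall>n\<le>N. norm (e n) \<le> C * h^k)"
      using error_bound[OF W, of T] T_pos by auto
    from transfer[OF this] eventually_gt_at_top[of 0]
    have "\<forall>\<^sub>F N in sequentially. \<forall>n\<le>N. norm (e N n) \<le> C * (T / real N)^k"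
    proof eventually_elim
      case (elim N)
      have "real N * (T / real N) \<le> T"
        using elim(2) by simp
      with elim(1) e_0 recursion show ?case
        by blast
    qed
    then show ?thesis
      by blast
  qed
  show ?thesis
    using transfer[OF eventually_diagonalization] bound[OF unif_bigo_theta] bound[OF W2] bound[OF W3]
      error[of 1] error[of 2] W2 W3
    by (simp add: numeral_2_eq_2 numeral_3_eq_3)
qed

end
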